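(* Suppose that $k \geq 2$ and $b \geq 3$ are integers, and let $d_1,d_2 \in \{0,1,\dots,b-1\}$ be distinct and coprime. Set $B := b^{6k^2}$. Let $n$ be a positive integer with $k \mid n$, set $N := b^n$, let $\delta \in (0,1)$ and let $\theta \in \mathbb{R}/\mathbb{Z}$. Suppose that $|\widehat{\mu_n}(\theta)| \geq \delta$ and that $N \geq (2/\delta)^{B}$. Then there is a positive integer $q \leq (2/\delta)^{B}$ such that $\Vert \theta q \Vert \leq (2/\delta)^{B} N^{-k}$.
   Context: For a real number (or element of $\mathbb{R}/\mathbb{Z}$) $x$, $\Vert x \Vert$ denotes the distance from $x$ to the nearest integer, and $e(x) = e^{2\pi i x}$. The probability measure $\mu_n$ on $\mathbb{Z}$ (depending on $k,b,d_1,d_2$) is defined by $\mu_n(m) = 2^{-n}$ if $m = \big(\sum_{i=0}^{n-1} x_i b^i\big)^k$ for some $x_0,\dots,x_{n-1} \in \{d_1,d_2\}$, and $\mu_n(m) = 0$ otherwise. Its Fourier transform is $\widehat{\mu_n}(\theta) := \sum_{m \in \mathbb{Z}} \mu_n(m) e(m\theta)$. *)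

theory Defs
  imports "HOL-Analysis.Analysis"
begin

text \<open>Functions on the circle \<open>\<real>/\<int>\<close> are represented by functions on the reals of period 1.\<close>

definition dist_int :: "real \<Rightarrow> real"
  where "dist_int x = \<bar>x - of_int (round x)\<bar>"

definition exp2pi :: "real \<Rightarrow> complex"
  where "exp2pi x = exp (2 * of_real pi * \<i> * of_real x)"

text \<open>The mass function of the measure \<open>\<mu>\<^sub>n\<close> on the integers, for the exponent \<open>k\<close>, the base \<open>b\<close>
  and the digits \<open>d1\<close>, \<open>d2\<close>.\<close>

definition mu :: "nat \<Rightarrow> nat \<Rightarrow> nat \<Rightarrow> nat \<Rightarrow> nat \<Rightarrow> int \<Rightarrow> real"
  where "mu k b d1 d2 n m =
    (if \<exists>x :: nat \<Rightarrow> nat. (\<forall>i<n. x i \<in> {d1, d2}) \<and> m = int ((\<Sum>i<n. x i * b ^ i) ^ k)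
     then 1 / 2 ^ n else 0)"

text \<open>The sum below has finite support, since \<^term>\<open>mu k b d1 d2 n\<close> is nonzero at no more than
  \<open>2 ^ n\<close> integers.\<close>

definition mu_hat :: "nat \<Rightarrow> nat \<Rightarrow> nat \<Rightarrow> nat \<Rightarrow> nat \<Rightarrow> real \<Rightarrow> complex"
  where "mu_hat k b d1 d2 n \<theta> =
    (\<Sum>\<^sub>\<infinity>m::int. of_real (mu k b d1 d2 n m) * exp2pi (of_int m * \<theta>))"

end

theory Submission
  imports Defs
begin

text \<open>
  Write \<open>D = b ^ k\<close>. In the base \<open>b\<close> expansion of the integers \<open>x\<close> that underlie the exponential sum, keep \<open>k\<close> windows of
  digits free, the \<open>j\<close>-th one consisting of consecutive positions congruent to \<open>j\<close> modulo \<open>k\<close>, and fix all other digits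
  favourably. As the phase is a polynomial of degree \<open>k\<close> in the sum of the contributions of the windows, Cauchy--Schwarz
  applied once for each window replaces it by \<open>c * z\<^sub>0 * \<dots> * z\<^bsub>k-1\<^esub>\<close>, where \<open>z\<^sub>j\<close> runs over differences of
  elements of the \<open>j\<close>-th window.

  Averaging over the last window alone gives a product of squared cosines, which is large only if the argument has few nonzero
  digits in base \<open>D\<close>. There are few such digit patterns, so if the last window is a large constant times longer than the
  others, two values of \<open>z\<^sub>0\<close> (for suitable nonzero \<open>z\<^sub>1, \<dots>, z\<^bsub>k-2\<^esub>\<close>) give the same pattern. Their difference
  provides a nonzero integer \<open>q\<close> of moderate size with \<open>\<parallel>q c D^l\<parallel> \<le> D^(-r) / 2\<close>; here \<open>r\<close> is the length of the last
  window and \<open>l\<close> the total shift of the windows, which can be any number from \<open>0\<close> to about \<open>n\<close>. Comparing successive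
  values of \<open>l\<close> shows that the multiplier \<open>q\<close> belonging to \<open>l = 0\<close> works for all \<open>l\<close>, and that the deviation of \<open>q c\<close>
  from its nearest integer really is smaller by a factor \<open>D ^ l\<close>.
\<close>

subsection \<open>Averages over cubes and iterated Cauchy--Schwarz\<close>

lemma exp2pi_cis: "exp2pi x = cis (2 * pi * x)"
  by (simp add: exp2pi_def cis_conv_exp mult_ac)

lemma exp2pi_add: "exp2pi (x + y) = exp2pi x * exp2pi y"
  by (simp add: exp2pi_cis cis_mult ring_distribs)

lemma exp2pi_diff: "exp2pi (x - y) = exp2pi x * cnj (exp2pi y)"
  by (simp add: exp2pi_cis cis_cnj cis_mult ring_distribs)

lemma exp2pi_0 [simp]: "exp2pi 0 = 1"
  by (simp add: exp2pi_cis)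

lemma Re_exp2pi: "Re (exp2pi x) = cos (2 * pi * x)"
  by (simp add: exp2pi_cis)

lemma exp2pi_sum: "finite A \<Longrightarrow> exp2pi (sum f A) = (\<Prod>x\<in>A. exp2pi (f x))"
  by (induction A rule: finite_induct) (auto simp: exp2pi_add)

text \<open>A choice between two digits at each position is encoded by the set of positions holding
  the second digit, and \<open>g\<close> weighs the positions (later \<open>b ^ i\<close>). Each
  list entry is a window, averaged over independently.\<close>

primrec cube_avg :: "('a \<Rightarrow> real) \<Rightarrow> 'a set list \<Rightarrow> (real \<Rightarrow> complex) \<Rightarrow> complex" where
  "cube_avg g [] f = f 0"
| "cube_avg g (I # Is) f =
    (\<Sum>S\<in>Pow I. cube_avg g Is (\<lambda>t. f (sum g S + t))) / 2 ^ card I"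

text \<open>The average of \<open>cos (2 * pi * c * z)\<close> over products \<open>z\<close> of one
  difference \<open>sum g S - sum g T\<close> per window. The product accumulates in
  \<open>c\<close>, so removing a window leaves the same function at a new coefficient.\<close>

primrec diff_avg :: "('a \<Rightarrow> real) \<Rightarrow> 'a set list \<Rightarrow> real \<Rightarrow> real" where
  "diff_avg g [] c = cos (2 * pi * c)"
| "diff_avg g (I # Is) c =
    (\<Sum>S\<in>Pow I. \<Sum>T\<in>Pow I. diff_avg g Is (c * (sum g S - sum g T))) / 4 ^ card I"

lemma cube_avg_sum: "cube_avg g Is (\<lambda>t. \<Sum>x\<in>X. f x t) = (\<Sum>x\<in>X. cube_avg g Is (f x))"
proof (induction Is arbitrary: f)
  case (Cons I Is)
  show ?case
    by (simp add: Cons.IH sum_divide_distrib[symmetric]) (subst sum.swap, simp)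
qed simp

lemma cube_avg_divide: "cube_avg g Is (\<lambda>t. f t / c) = cube_avg g Is f / c"
  by (induction Is arbitrary: f) (auto simp: sum_divide_distrib mult.commute)

lemma avg_power_le:
  fixes f :: "'b \<Rightarrow> real"
  assumes "finite A" "A \<noteq> {}" "\<And>x. x \<in> A \<Longrightarrow> f x \<ge> 0"
  shows "((\<Sum>x\<in>A. f x) / real (card A)) ^ 2 ^ j \<le> (\<Sum>x\<in>A. f x ^ 2 ^ j) / real (card A)"
proof (induction j)
  case (Suc j)
  have "((\<Sum>x\<in>A. f x) / real (card A)) ^ 2 ^ Suc j = (((\<Sum>x\<in>A. f x) / real (card A)) ^ 2 ^ j)\<^sup>2"
    by (simp add: power_mult[symmetric] mult.commute)
  also have "\<dots> \<le> ((\<Sum>x\<in>A. f x ^ 2 ^ j) / real (card A))\<^sup>2"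
    by (intro power_mono Suc zero_le_power divide_nonneg_nonneg sum_nonneg assms) auto
  also have "\<dots> \<le> (\<Sum>x\<in>A. (f x ^ 2 ^ j)\<^sup>2) / real (card A)"
    using sum_squared_le_sum_of_squares[of "\<lambda>x. f x ^ 2 ^ j" A] assms
    by (simp add: power_divide field_simps power2_eq_square[of "real (card A)"] card_gt_0_iff)
  finally show ?case by (simp add: power_mult[symmetric] mult.commute)
qed simp

lemma norm_avg_power_le:
  fixes f :: "'b \<Rightarrow> complex"
  assumes "finite A" "A \<noteq> {}"
  shows "norm ((\<Sum>x\<in>A. f x) / of_nat (card A)) ^ 2 ^ j \<le> (\<Sum>x\<in>A. norm (f x) ^ 2 ^ j) / real (card A)"
proof -
  have "norm ((\<Sum>x\<in>A. f x) / of_nat (card A)) ^ 2 ^ j \<le> ((\<Sum>x\<in>A. norm (f x)) / real (card A)) ^ 2 ^ j"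
    by (intro power_mono) (auto simp: norm_divide intro!: divide_right_mono norm_sum)
  also have "\<dots> \<le> (\<Sum>x\<in>A. norm (f x) ^ 2 ^ j) / real (card A)"
    by (rule avg_power_le) (use assms in auto)
  finally show ?thesis .
qed

lemma norm_cube_avg_sq_le:
  assumes "\<forall>I\<in>set Is. finite I"
  shows "(norm (cube_avg g Is f))\<^sup>2 \<le> Re (cube_avg g Is (\<lambda>t. f t * cnj (f t)))"
  using assms
proof (induction Is arbitrary: f)
  case Nil
  then show ?case by (simp add: complex_mult_cnj cmod_power2)
next
  case (Cons I Is)
  have "(norm (cube_avg g (I # Is) f))\<^sup>2
      \<le> (\<Sum>S\<in>Pow I. (norm (cube_avg g Is (\<lambda>t. f (sum g S + t))))\<^sup>2) / 2 ^ card I"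
    using norm_avg_power_le[of "Pow I" "\<lambda>S. cube_avg g Is (\<lambda>t. f (sum g S + t))" 1] Cons.prems
    by (simp add: card_Pow Pow_not_empty)
  also have "\<dots> \<le> (\<Sum>S\<in>Pow I. Re (cube_avg g Is (\<lambda>t. f (sum g S + t) * cnj (f (sum g S + t))))) / 2 ^ card I"
    using Cons.prems by (intro divide_right_mono sum_mono Cons.IH) auto
  also have "\<dots> = Re (cube_avg g (I # Is) (\<lambda>t. f t * cnj (f t)))"
    using Re_divide_of_real[of _ "2 ^ card I"] by simp
  finally show ?case .
qed

text \<open>Cauchy--Schwarz over all windows but the first: \<open>F\<close> is the average over the
  first one, so \<open>F * cnj F\<close> turns it into pairs \<open>S\<close>, \<open>T\<close>
  while the other windows stay single.\<close>

lemma norm_cube_avg_Cons_sq_le: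
  assumes "\<forall>J\<in>set (I # Is). finite J"
  shows "(norm (cube_avg g (I # Is) f))\<^sup>2 \<le> Re ((\<Sum>S\<in>Pow I. \<Sum>T\<in>Pow I.
           cube_avg g Is (\<lambda>t. f (sum g S + t) * cnj (f (sum g T + t)))) / 4 ^ card I)"
proof -
  define F where "F t = (\<Sum>S\<in>Pow I. f (sum g S + t)) / 2 ^ card I" for t
  have eq: "cube_avg g (I # Is) f = cube_avg g Is F"
    by (simp add: F_def[abs_def] cube_avg_divide cube_avg_sum)
  have "F t * cnj (F t) = (\<Sum>S\<in>Pow I. \<Sum>T\<in>Pow I. f (sum g S + t) * cnj (f (sum g T + t))) / 4 ^ card I" for t
    by (simp add: F_def sum_product power_mult_distrib[symmetric])
  then have "cube_avg g Is (\<lambda>t. F t * cnj (F t)) = (\<Sum>S\<in>Pow I. \<Sum>T\<in>Pow I.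
           cube_avg g Is (\<lambda>t. f (sum g S + t) * cnj (f (sum g T + t)))) / 4 ^ card I"
    by (simp add: cube_avg_divide cube_avg_sum)
  then show ?thesis
    using norm_cube_avg_sq_le[of Is g F] assms eq by simp
qed

section \<open>Differencing of polynomial phases\<close>

lemma degree_pcompose_shift: "degree (pcompose Q [:a, 1:]) = degree (Q :: real poly)"
  by (simp add: degree_pcompose)

lemma coeff_pcompose_shift:
  fixes Q :: "real poly"
  assumes "degree Q \<le> Suc p"
  shows "coeff (pcompose Q [:a, 1:]) (Suc p) = coeff Q (Suc p)"
    and "coeff (pcompose Q [:a, 1:]) p = coeff Q p + real (Suc p) * a * coeff Q (Suc p)"
proof -
  have "coeff (pcompose Q [:a, 1:]) (Suc p) = coeff Q (Suc p) \<and>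
    coeff (pcompose Q [:a, 1:]) p = coeff Q p + real (Suc p) * a * coeff Q (Suc p)"
    using assms
  proof (induction p arbitrary: Q)
    case 0
    obtain c R where Q: "Q = pCons c R" by (cases Q)
    have "degree R = 0" using 0 Q by (auto split: if_splits)
    then obtain e where "R = [:e:]" by (rule degree_eq_zeroE)
    then show ?case by (simp add: Q pcompose_pCons)
  next
    case (Suc p)
    obtain c R where Q: "Q = pCons c R" by (cases Q)
    have R: "degree R \<le> Suc p" using Suc.prems Q by (auto split: if_splits)
    then have "degree (pcompose R [:a, 1:]) \<le> Suc p" by (simp add: degree_pcompose_shift)
    then have "coeff (pcompose R [:a, 1:]) (Suc (Suc p)) = 0" "coeff R (Suc (Suc p)) = 0"
      using R by (auto intro!: coeff_eq_0)
    then show ?case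
      using Suc.IH[OF R] by (simp add: Q pcompose_pCons algebra_simps)
  qed
  then show "coeff (pcompose Q [:a, 1:]) (Suc p) = coeff Q (Suc p)"
    and "coeff (pcompose Q [:a, 1:]) p = coeff Q p + real (Suc p) * a * coeff Q (Suc p)" by auto
qed

text \<open>The factor \<open>Suc p\<close> gained by the top coefficient builds up the factorial in
  \<open>iterated_Cauchy_Schwarz\<close>.\<close>

lemma poly_difference:
  fixes Q :: "real poly" and a a' :: real
  assumes "degree Q \<le> Suc p"
  defines "R \<equiv> pcompose Q [:a, 1:] - pcompose Q [:a', 1:]"
  shows "degree R \<le> p" "coeff R p = real (Suc p) * coeff Q (Suc p) * (a - a')"
    "poly R t = poly Q (a + t) - poly Q (a' + t)"
proof -
  show "degree R \<le> p"
  proof (rule degree_le, intro allI impI)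
    fix i assume "p < i"
    then show "coeff R i = 0"
      using coeff_pcompose_shift(1)[OF assms(1)] assms(1)
      by (cases "i = Suc p") (auto simp: R_def coeff_eq_0 degree_pcompose_shift)
  qed
  show "coeff R p = real (Suc p) * coeff Q (Suc p) * (a - a')"
    by (simp add: R_def coeff_pcompose_shift(2)[OF assms(1)] algebra_simps)
  show "poly R t = poly Q (a + t) - poly Q (a' + t)"
    by (simp add: R_def poly_pcompose add.commute)
qed

text \<open>One squaring doubles the first window and lowers the degree of the phase by one; the
  remaining power of the norm is moved inside the average over pairs by
  \<open>norm_avg_power_le\<close>.\<close>

lemma iterated_Cauchy_Schwarz:
  fixes Q :: "real poly"
  assumes "\<forall>I\<in>set Is. finite I" "Is \<noteq> []" "degree Q \<le> length Is"
  shows "norm (cube_avg g Is (\<lambda>t. exp2pi (poly Q t))) ^ 2 ^ length Is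
           \<le> diff_avg g Is (fact (length Is) * coeff Q (length Is))"
  using assms
proof (induction Is arbitrary: Q)
  case (Cons I Is)
  define p where "p = length Is"
  define R where "R S T = pcompose Q [:sum g S, 1:] - pcompose Q [:sum g T, 1:]" for S T
  have deg: "degree Q \<le> Suc p" using Cons.prems p_def by simp
  note R = poly_difference[OF deg, of "sum g S" "sum g T" for S T, folded R_def]
  define F where "F S T = cube_avg g Is (\<lambda>t. exp2pi (poly (R S T) t))" for S T
  have fin: "finite I" using Cons.prems by auto
  have main: "(norm (cube_avg g (I # Is) (\<lambda>t. exp2pi (poly Q t))))\<^sup>2
      \<le> Re ((\<Sum>S\<in>Pow I. \<Sum>T\<in>Pow I. F S T) / 4 ^ card I)"
    using norm_cube_avg_Cons_sq_le[OF Cons.prems(1), of g "\<lambda>t. exp2pi (poly Q t)"]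
    by (simp add: F_def R(3) exp2pi_diff)
  have card: "card (Pow I \<times> Pow I) = 4 ^ card I"
    using fin by (simp add: card_Pow card_cartesian_product power_mult_distrib[symmetric])
  have coeff: "fact p * coeff (R S T) p = fact (Suc p) * coeff Q (Suc p) * (sum g S - sum g T)" for S T
    by (simp add: R(2) algebra_simps)
  show ?case
  \<comment> \<open>When no window remains, the phase is constant and its exponential has norm 1.
    The cosine has to come from the real part in \<open>main\<close>, so the induction hypothesis
    starts at one window.\<close>
  proof (cases "Is = []")
    case True
    have "Re (F S T) = diff_avg g [] (coeff Q 1 * (sum g S - sum g T))" for S T
      using True R(2)[of S T] R(1)[of S T] by (simp add: F_def Re_exp2pi p_def poly_0_coeff_0)
    then show ?thesis
      using main True by (simp add: Re_divide_of_real[of _ "4 ^ card I", simplified])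
  next
    case False
    have "norm (cube_avg g (I # Is) (\<lambda>t. exp2pi (poly Q t))) ^ 2 ^ Suc p
        = ((norm (cube_avg g (I # Is) (\<lambda>t. exp2pi (poly Q t))))\<^sup>2) ^ 2 ^ p"
      by (simp add: power_mult[symmetric])
    also have "\<dots> \<le> norm ((\<Sum>S\<in>Pow I. \<Sum>T\<in>Pow I. F S T) / 4 ^ card I) ^ 2 ^ p"
      using main complex_Re_le_cmod order_trans by (intro power_mono) (blast, simp)
    also have "(\<Sum>S\<in>Pow I. \<Sum>T\<in>Pow I. F S T) / 4 ^ card I
        = (\<Sum>z\<in>Pow I \<times> Pow I. F (fst z) (snd z)) / of_nat (card (Pow I \<times> Pow I))"
      by (simp add: sum.cartesian_product case_prod_beta card)
    also have "norm \<dots> ^ 2 ^ p \<le> (\<Sum>z\<in>Pow I \<times> Pow I. norm (F (fst z) (snd z)) ^ 2 ^ p) / real (card (Pow I \<times> Pow I))"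
      using fin by (intro norm_avg_power_le) auto
    also have "\<dots> = (\<Sum>S\<in>Pow I. \<Sum>T\<in>Pow I. norm (F S T) ^ 2 ^ p) / 4 ^ card I"
      by (simp add: sum.cartesian_product case_prod_beta card)
    also have "\<dots> \<le> (\<Sum>S\<in>Pow I. \<Sum>T\<in>Pow I. diff_avg g Is (fact p * coeff (R S T) p)) / 4 ^ card I"
      using Cons.prems False R(1) unfolding F_def p_def
      by (intro divide_right_mono sum_mono Cons.IH) auto
    also have "\<dots> = diff_avg g (I # Is) (fact (Suc p) * coeff Q (Suc p))"
      by (simp add: coeff)
    finally show ?thesis by (simp add: p_def)
  qed
qed simp

section \<open>Fixing the digits outside the windows\<close>

lemma sum_Pow_split:
  fixes f :: "real \<Rightarrow> complex"
  assumes "finite A" "W \<subseteq> A"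
  shows "(\<Sum>S\<in>Pow A. f (sum g S)) = (\<Sum>S\<in>Pow (A - W). \<Sum>T\<in>Pow W. f (sum g T + sum g S))"
proof -
  have "(\<Sum>S\<in>Pow A. f (sum g S)) = (\<Sum>(S, T)\<in>Pow (A - W) \<times> Pow W. f (sum g T + sum g S))"
  proof (rule sum.reindex_bij_witness[of _ "\<lambda>(S, T). S \<union> T" "\<lambda>S. (S - W, S \<inter> W)"])
    fix S assume "S \<in> Pow A"
    then have "finite S" using assms finite_subset by auto
    then show "(case (S - W, S \<inter> W) of (S, T) \<Rightarrow> f (sum g T + sum g S)) = f (sum g S)"
      using sum.Int_Diff[of S g W] by simp
  qed (use assms in auto)
  then show ?thesis by (simp add: sum.cartesian_product)
qed

lemma exists_ge_norm_avg:
  fixes f :: "'b \<Rightarrow> complex"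
  assumes "finite A" "A \<noteq> {}"
  shows "\<exists>x\<in>A. norm ((\<Sum>x\<in>A. f x) / of_nat (card A)) \<le> norm (f x)"
proof (rule ccontr)
  assume "\<not> ?thesis"
  then have *: "norm (f x) < norm ((\<Sum>x\<in>A. f x) / of_nat (card A))" if "x \<in> A" for x
    using that by force
  have "norm (\<Sum>x\<in>A. f x) \<le> (\<Sum>x\<in>A. norm (f x))" by (rule norm_sum)
  also have "\<dots> < (\<Sum>x\<in>A. norm ((\<Sum>x\<in>A. f x) / of_nat (card A)))"
    using assms * by (intro sum_strict_mono) auto
  also have "\<dots> = norm (\<Sum>x\<in>A. f x)"
    using assms by (simp add: norm_divide)
  finally show False by simp
qed

text \<open>Some choice of the digits outside the windows does at least as well as their mean. The
  induction averages over \<open>W\<close> first, which replaces \<open>f\<close> by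
  \<open>F\<close> and \<open>A\<close> by \<open>A - W\<close>.\<close>

lemma restrict_to_windows:
  assumes "finite A" "\<forall>W\<in>set Ws. W \<subseteq> A" "sorted_wrt (\<lambda>V W. V \<inter> W = {}) Ws"
  shows "\<exists>S. S \<subseteq> A \<and> norm ((\<Sum>S\<in>Pow A. f (sum g S)) / 2 ^ card A)
           \<le> norm (cube_avg g Ws (\<lambda>t. f (sum g S + t)))"
  using assms
proof (induction Ws arbitrary: A f)
  case Nil
  show ?case using exists_ge_norm_avg[of "Pow A" "\<lambda>S. f (sum g S)"] Nil
    by (auto simp: card_Pow)
next
  case (Cons W Ws)
  define F where "F t = (\<Sum>T\<in>Pow W. f (sum g T + t)) / 2 ^ card W" for t
  have W: "W \<subseteq> A" and "finite W" using Cons.prems by (auto intro: finite_subset)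
  have "\<forall>V\<in>set Ws. V \<subseteq> A - W" using Cons.prems by fastforce
  then obtain S where S: "S \<subseteq> A - W" "norm ((\<Sum>S\<in>Pow (A - W). F (sum g S)) / 2 ^ card (A - W))
           \<le> norm (cube_avg g Ws (\<lambda>t. F (sum g S + t)))"
    using Cons.IH[of "A - W" F] Cons.prems by auto
  have "card A = card W + card (A - W)"
    using W Cons.prems(1) by (metis card_Diff_subset card_mono le_add_diff_inverse finite_subset)
  then have "(\<Sum>S\<in>Pow (A - W). F (sum g S)) / 2 ^ card (A - W) = (\<Sum>S\<in>Pow A. f (sum g S)) / 2 ^ card A"
    by (simp add: sum_Pow_split[OF Cons.prems(1) W] F_def sum_divide_distrib[symmetric] power_add)
  moreover have "cube_avg g Ws (\<lambda>t. F (sum g S + t)) = cube_avg g (W # Ws) (\<lambda>t. f (sum g S + t))"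
    by (simp add: F_def cube_avg_divide cube_avg_sum add_ac)
  ultimately show ?case using S by (intro exI[of _ S]) auto
qed

subsection \<open>Distance to the nearest integer\<close>

lemma dist_int_le: "dist_int x \<le> \<bar>x - of_int z\<bar>"
  unfolding dist_int_def by (rule round_diff_minimal)

lemma dist_int_le_half: "dist_int x \<le> 1 / 2"
  unfolding dist_int_def by (metis abs_minus_commute of_int_round_abs_le)

lemma dist_int_nonneg: "0 \<le> dist_int x"
  by (simp add: dist_int_def)

lemma dist_int_add_of_int [simp]: "dist_int (x + of_int z) = dist_int x"
proof (rule antisym)
  show "dist_int (x + of_int z) \<le> dist_int x"
    using dist_int_le[of "x + of_int z" "round x + z"] by (simp add: dist_int_def)
  show "dist_int x \<le> dist_int (x + of_int z)"
    using dist_int_le[of x "round (x + of_int z) - z"] by (simp add: dist_int_def algebra_simps)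
qed

lemma dist_int_minus [simp]: "dist_int (- x) = dist_int x"
proof -
  have "dist_int (- y) \<le> dist_int y" for y
    using dist_int_le[of "- y" "- round y"] by (simp add: dist_int_def abs_minus_commute)
  from this[of x] this[of "- x"] show ?thesis by simp
qed

lemma dist_int_diff_le: "dist_int (x - y) \<le> dist_int x + dist_int y"
  using dist_int_le[of "x - y" "round x - round y"] by (simp add: dist_int_def)

lemma dist_int_eq_abs:
  assumes "\<bar>x\<bar> \<le> 1 / 2"
  shows "dist_int x = \<bar>x\<bar>"
proof (rule antisym)
  show "dist_int x \<le> \<bar>x\<bar>" using dist_int_le[of x 0] by simp
  show "\<bar>x\<bar> \<le> dist_int x"
  proof (cases "round x = 0")
    case False
    then have "\<bar>real_of_int (round x)\<bar> \<ge> 1" by linarith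
    then show ?thesis using assms by (simp add: dist_int_def)
  qed (simp add: dist_int_def)
qed

lemma dist_int_mult_nat: "dist_int (real m * x) \<le> real m * dist_int x"
  using dist_int_le[of "real m * x" "int m * round x"]
  by (simp add: dist_int_def abs_mult flip: right_diff_distrib)

text \<open>A weak Jordan inequality; \<open>2 / 5\<close> suffices because
  \<open>2 / 5 * pi > 1\<close>, which \<open>cos_pi_sq_le\<close> uses.\<close>

lemma sin_ge_linear:
  fixes x :: real
  assumes "0 \<le> x" "x \<le> pi / 2"
  shows "2 / 5 * x \<le> sin x"
\<comment> \<open>Up to \<open>pi / 3\<close> the mean value theorem applies with
  \<open>cos z\<close> at least \<open>1 / 2\<close>; beyond it \<open>sin x\<close> is at least
  \<open>sqrt 3 / 2\<close>, while \<open>2 / 5 * x\<close> is below \<open>4 / 5\<close>.\<close>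
proof (cases "x \<le> pi / 3")
  case True
  show ?thesis
  proof (cases "x = 0")
    case False
    then have "\<exists>z>0. z < x \<and> sin x - sin 0 = (x - 0) * cos z"
      using assms by (intro MVT2) (auto intro!: derivative_eq_intros)
    then obtain z where z: "0 < z" "z < x" "sin x = x * cos z" by auto
    have "cos (pi / 3) \<le> cos z" using z True by (intro cos_monotone_0_pi_le) auto
    then show ?thesis using z assms(1) mult_left_mono[of "2 / 5" "cos z" x] by (simp add: cos_60)
  qed simp
next
  case False
  have "sin (pi / 3) \<le> sin x" using False assms by (intro sin_monotone_2pi_le) auto
  moreover have "(1.7 :: real) \<le> sqrt 3" by (rule real_le_rsqrt) (simp add: power2_eq_square)
  ultimately show ?thesis using assms(2) pi_less_4 by (simp add: sin_60)
qed

lemma cos_pi_sq_le: "(cos (pi * x))\<^sup>2 \<le> 1 - (dist_int x)\<^sup>2"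
proof -
  define y where "y = \<bar>x - of_int (round x)\<bar>"
  have y: "y = dist_int x" "0 \<le> y" "y \<le> 1 / 2"
    using dist_int_le_half by (auto simp: y_def dist_int_def)
  have "y \<le> 2 / 5 * (pi * y)" using y(2) pi_gt3 mult_right_mono[of 3 pi y] by simp
  also have "\<dots> \<le> sin (pi * y)" using y by (intro sin_ge_linear) auto
  finally have "y\<^sup>2 \<le> (sin (pi * y))\<^sup>2" using y(2) by (intro power_mono)
  also have "(sin (pi * y))\<^sup>2 = (sin (pi * (x - of_int (round x))))\<^sup>2"
  proof -
    have "(sin (pi * \<bar>z\<bar>))\<^sup>2 = (sin (pi * z))\<^sup>2" for z :: real
      by (simp add: abs_if)
    then show ?thesis unfolding y_def .
  qed
  also have "\<dots> = (sin (pi * x))\<^sup>2"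
  proof -
    have "sin (pi * of_int (round x)) = 0" "(cos (pi * of_int (round x)))\<^sup>2 = 1"
      using sin_integer_2pi sin_cos_squared_add[of "pi * of_int (round x)"]
      by (auto simp: sin_zero_iff_int2 mult.commute)
    then show ?thesis by (simp add: right_diff_distrib sin_diff power_mult_distrib)
  qed
  finally show ?thesis unfolding y(1)[symmetric] using sin_cos_squared_add[of "pi * x"] by linarith
qed

subsection \<open>Digit patterns\<close>

text \<open>The double sum is the real part of \<open>F * cnj F\<close>, and \<open>F\<close>
  factors over the positions into \<open>exp2pi (c * g i) + 1\<close>, whose squared norm is four
  times a squared cosine.\<close>

lemma diff_avg_single:
  assumes "finite I"
  shows "diff_avg g [I] c = (\<Prod>i\<in>I. (cos (pi * (c * g i)))\<^sup>2)"
proof -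
  define F where "F = (\<Sum>S\<in>Pow I. exp2pi (c * sum g S))"
  have cos_diff: "cos (2 * pi * (c * (s - t))) = Re (exp2pi (c * s) * cnj (exp2pi (c * t)))" for s t
    by (simp only: exp2pi_diff[symmetric] Re_exp2pi right_diff_distrib)
  have "diff_avg g [I] c = Re (F * cnj F) / 4 ^ card I"
    unfolding F_def cnj_sum sum_product Re_sum diff_avg.simps cos_diff ..
  also have "F = (\<Sum>S\<in>Pow I. (\<Prod>i\<in>S. exp2pi (c * g i)) * (\<Prod>i\<in>I - S. 1))"
    unfolding F_def using assms
    by (intro sum.cong) (auto simp: sum_distrib_left exp2pi_sum finite_subset)
  also have "\<dots> = (\<Prod>i\<in>I. exp2pi (c * g i) + 1)"
    by (rule prod_add[symmetric]) (rule assms)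
  also have "Re (\<dots> * cnj \<dots>) = (\<Prod>i\<in>I. (norm (exp2pi (c * g i) + 1))\<^sup>2)"
    by (metis (no_types, lifting) Re_complex_of_real complex_norm_square prod.cong prod_norm prod_power_distrib)
  also have "\<dots> = (\<Prod>i\<in>I. 4 * (cos (pi * (c * g i)))\<^sup>2)"
  proof (rule prod.cong[OF refl])
    fix i
    have "(norm (exp2pi x + 1))\<^sup>2 = 4 * (cos (pi * x))\<^sup>2" for x
    proof -
      have "(norm (exp2pi x + 1))\<^sup>2 = (cos (2 * (pi * x)) + 1)\<^sup>2 + (sin (2 * (pi * x)))\<^sup>2"
        by (simp add: cmod_power2 exp2pi_cis mult.assoc)
      also have "\<dots> = 2 + 2 * cos (2 * (pi * x))"
        using sin_cos_squared_add[of "2 * (pi * x)"] by (simp add: power2_eq_square algebra_simps)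
      also have "\<dots> = 4 * (cos (pi * x))\<^sup>2" by (simp add: cos_double_cos)
      finally show ?thesis .
    qed
    then show "(norm (exp2pi (c * g i) + 1))\<^sup>2 = 4 * (cos (pi * (c * g i)))\<^sup>2" by blast
  qed
  also have "\<dots> = 4 ^ card I * (\<Prod>i\<in>I. (cos (pi * (c * g i)))\<^sup>2)"
    by (simp add: prod.distrib)
  finally show ?thesis by simp
qed

lemma diff_avg_le_1:
  assumes "\<forall>I\<in>set Is. finite I"
  shows "diff_avg g Is c \<le> 1"
  using assms
proof (induction Is arbitrary: c)
  case (Cons I Is)
  have "(\<Sum>S\<in>Pow I. \<Sum>T\<in>Pow I. diff_avg g Is (c * (sum g S - sum g T))) \<le> (\<Sum>S\<in>Pow I. \<Sum>T\<in>Pow I. 1)"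
    using Cons by (intro sum_mono) auto
  also have "\<dots> = 4 ^ card I"
    using Cons.prems by (simp add: card_Pow power_mult_distrib[symmetric])
  finally show ?case by simp
qed simp

text \<open>The deviation \<open>y\<close> of \<open>x\<close> from its nearest integer can be
  multiplied by \<open>D\<close> repeatedly without exceeding \<open>1 / 2\<close>, since a value
  below \<open>1 / (2 * D)\<close> leaves room for one more factor.\<close>

lemma dist_int_le_of_scaled:
  fixes D :: nat
  assumes "D > 0" "\<And>a. a < r \<Longrightarrow> dist_int (x * real D ^ a) < 1 / (2 * real D)"
  shows "dist_int x \<le> 1 / (2 * real D ^ r)"
proof -
  define y where "y = x - of_int (round x)"
  have "\<bar>y\<bar> * real D ^ a \<le> 1 / 2" if "a \<le> r" for a
    using that
  proof (induction a)
    case 0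
    then show ?case using dist_int_le_half[of x] by (simp add: y_def dist_int_def)
  next
    case (Suc a)
    then have "\<bar>y * real D ^ a\<bar> \<le> 1 / 2" by (simp add: abs_mult)
    then have "\<bar>y * real D ^ a\<bar> = dist_int (y * real D ^ a)" by (simp add: dist_int_eq_abs)
    also have "\<dots> = dist_int (x * real D ^ a)"
      using dist_int_add_of_int[of "x * real D ^ a" "- round x * int D ^ a"]
      by (simp add: y_def algebra_simps)
    also have "\<dots> < 1 / (2 * real D)" using Suc by (intro assms(2)) auto
    finally show ?case using assms(1) by (simp add: abs_mult field_simps)
  qed
  from this[of r] show ?thesis
    using assms(1) by (simp add: y_def dist_int_def field_simps)
qed

text \<open>The code \<open>4 * D\<close> stands for a zero digit. Zero digits get only one code, so that numbers with few nonzero digits have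
  few codes; the cells of the remaining codes are short enough that equal codes force equal digits.\<close>

definition digit_code :: "nat \<Rightarrow> real \<Rightarrow> nat" where
  "digit_code D x = (if dist_int x < 1 / (4 * real D) then 4 * D else nat \<lfloor>4 * real D * frac x\<rfloor>)"

lemma digit_code_lt:
  assumes "D > 0" "\<not> dist_int x < 1 / (4 * real D)"
  shows "digit_code D x < 4 * D"
proof -
  have "4 * real D * frac x < 4 * real D" using assms(1) frac_lt_1[of x] by simp
  then have "\<lfloor>4 * real D * frac x\<rfloor> < 4 * int D" by (simp add: floor_less_iff)
  then show ?thesis using assms by (simp add: digit_code_def)
qed

lemma digit_code_le: "D > 0 \<Longrightarrow> digit_code D x \<le> 4 * D"
  using digit_code_lt[of D x] by (auto simp: digit_code_def)

text \<open>Two points within \<open>1 / (4 * D)\<close> of integers are closer than twice that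
  modulo 1; the other cells have length \<open>1 / (4 * D)\<close>. The bound is the one
  \<open>dist_int_le_of_scaled\<close> asks for.\<close>

lemma digit_code_eq:
  assumes "D > 0" "digit_code D x = digit_code D y"
  shows "dist_int (x - y) < 1 / (2 * real D)"
proof (cases "dist_int x < 1 / (4 * real D)")
  case True
  then have "dist_int y < 1 / (4 * real D)"
    using assms digit_code_lt[of D y] by (metis digit_code_def less_irrefl)
  then show ?thesis using True dist_int_diff_le[of x y] by simp
next
  case False
  then have "\<not> dist_int y < 1 / (4 * real D)"
    using assms digit_code_lt[of D x] by (auto simp: digit_code_def)
  then have "\<lfloor>4 * real D * frac x\<rfloor> = \<lfloor>4 * real D * frac y\<rfloor>"
    using False assms by (simp add: digit_code_def eq_nat_nat_iff)
  then have "\<bar>4 * real D * frac x - 4 * real D * frac y\<bar> < 1" by linarith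
  then have "4 * real D * \<bar>frac x - frac y\<bar> < 1"
    by (simp add: abs_mult flip: right_diff_distrib)
  then have "\<bar>frac x - frac y\<bar> < 1 / (4 * real D)" using assms(1) by (simp add: field_simps)
  moreover have "dist_int (x - y) \<le> \<bar>frac x - frac y\<bar>"
    using dist_int_le[of "x - y" "\<lfloor>x\<rfloor> - \<lfloor>y\<rfloor>"] by (simp add: frac_def algebra_simps)
  moreover have "1 / (4 * real D) \<le> 1 / (2 * real D)" using assms(1) by (simp add: frac_le)
  ultimately show ?thesis by linarith
qed

lemma digit_weight_nonneg:
  assumes "D > 0"
  shows "0 \<le> 1 - 1 / (16 * (real D)\<^sup>2)"
proof -
  have "1 \<le> 16 * (real D)\<^sup>2" using assms one_le_power[of "real D" 2] by linarith
  then have "1 / (16 * (real D)\<^sup>2) \<le> 1 / 1" by (intro frac_le) auto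
  then show ?thesis by linarith
qed

text \<open>Separated points have distinct patterns of codes, and the summand of a point is at most the product of the weights of
  its codes, where a nonzero digit has small weight.\<close>

lemma separated_cos_prod_bound:
  fixes D :: nat
  assumes "finite X" "D > 0"
    and sep: "\<And>x y. x \<in> X \<Longrightarrow> y \<in> X \<Longrightarrow> x \<noteq> y \<Longrightarrow> dist_int (\<beta> x - \<beta> y) > 1 / (2 * real D ^ r)"
  shows "(\<Sum>x\<in>X. (\<Prod>a<r. (cos (pi * (\<beta> x * real D ^ a)))\<^sup>2) ^ h)
           \<le> (1 + 4 * real D * (1 - 1 / (16 * (real D)\<^sup>2)) ^ h) ^ r"
proof -
  define code where "code x = (\<lambda>a\<in>{..<r}. digit_code D (\<beta> x * real D ^ a))" for x
  \<comment> \<open>A nonzero digit is at distance at least \<open>1 / (4 * D)\<close> from the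
    integers, so \<open>cos_pi_sq_le\<close> bounds its squared cosine by
    \<open>lam\<close>.\<close>
  define lam where "lam = 1 - 1 / (16 * (real D)\<^sup>2)"
  define u where "u v = (if v = 4 * D then 1 else lam ^ h)" for v :: nat
  have lam: "0 \<le> lam" unfolding lam_def using assms(2) by (rule digit_weight_nonneg)
  have u: "0 \<le> u v" for v using lam by (simp add: u_def)
  have inj: "inj_on code X"
  proof (rule inj_onI, rule ccontr)
    fix x y assume xy: "x \<in> X" "y \<in> X" "code x = code y" "x \<noteq> y"
    have "dist_int ((\<beta> x - \<beta> y) * real D ^ a) < 1 / (2 * real D)" if "a < r" for a
      using fun_cong[OF xy(3), of a] that assms(2)
      by (simp add: code_def left_diff_distrib digit_code_eq)
    then have "dist_int (\<beta> x - \<beta> y) \<le> 1 / (2 * real D ^ r)"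
      by (rule dist_int_le_of_scaled[OF assms(2)])
    then show False using sep[OF xy(1,2,4)] by simp
  qed
  have codes: "code ` X \<subseteq> {..<r} \<rightarrow>\<^sub>E {..4 * D}"
    unfolding code_def using digit_code_le[OF assms(2)]
    by (intro image_subsetI) (auto simp: restrict_PiE_iff)
  have factor: "((cos (pi * z))\<^sup>2) ^ h \<le> u (digit_code D z)" for z
  proof (cases "dist_int z < 1 / (4 * real D)")
    case True
    then show ?thesis by (simp add: u_def digit_code_def power_le_one abs_square_le_1)
  next
    case False
    then have "(1 / (4 * real D))\<^sup>2 \<le> (dist_int z)\<^sup>2" by (intro power_mono) auto
    then have "(cos (pi * z))\<^sup>2 \<le> lam"
      using cos_pi_sq_le[of z] by (simp add: lam_def power_divide power_mult_distrib)
    then show ?thesis using digit_code_lt[OF assms(2) False] by (simp add: u_def power_mono)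
  qed
  have "(\<Sum>x\<in>X. (\<Prod>a<r. (cos (pi * (\<beta> x * real D ^ a)))\<^sup>2) ^ h) \<le> (\<Sum>x\<in>X. \<Prod>a<r. u (code x a))"
    by (intro sum_mono) (auto simp: prod_power_distrib code_def intro!: prod_mono factor)
  also have "\<dots> = (\<Sum>p\<in>code ` X. \<Prod>a<r. u (p a))"
    by (simp add: sum.reindex[OF inj])
  also have "\<dots> \<le> (\<Sum>p\<in>{..<r} \<rightarrow>\<^sub>E {..4 * D}. \<Prod>a<r. u (p a))"
    using codes by (intro sum_mono2 finite_PiE prod_nonneg) (auto simp: u)
  also have "\<dots> = (\<Prod>a<r. \<Sum>v\<le>4 * D. u v)"
    by (rule prod_sum_PiE[symmetric]) auto
  also have "(\<Sum>v\<le>4 * D. u v) = 1 + 4 * real D * lam ^ h"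
    by (simp add: u_def lessThan_Suc_atMost[symmetric])
  finally show ?thesis by (simp add: lam_def)
qed

subsection \<open>Windows of digits\<close>

lemma digit_sum_less:
  fixes x :: "nat \<Rightarrow> nat"
  assumes "\<And>i. i < n \<Longrightarrow> x i < b"
  shows "(\<Sum>i<n. x i * b ^ i) < b ^ n"
  using assms
proof (induction n)
  case (Suc n)
  have "(\<Sum>i<Suc n. x i * b ^ i) < b ^ n + x n * b ^ n" using Suc by simp
  also have "\<dots> = (1 + x n) * b ^ n" by simp
  also have "\<dots> \<le> b * b ^ n" using Suc.prems[of n] by (intro mult_right_mono) auto
  finally show ?case by simp
qed simp

lemma digit_sum_inj:
  fixes x y :: "nat \<Rightarrow> nat"
  assumes "\<And>i. i < n \<Longrightarrow> x i < b" "\<And>i. i < n \<Longrightarrow> y i < b"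
    and "(\<Sum>i<n. x i * b ^ i) = (\<Sum>i<n. y i * b ^ i)" "i < n"
  shows "x i = y i"
  using assms
proof (induction n)
  case (Suc n)
  have lt: "(\<Sum>i<n. x i * b ^ i) < b ^ n" "(\<Sum>i<n. y i * b ^ i) < b ^ n"
    using Suc.prems by (auto intro!: digit_sum_less)
  have eq: "(\<Sum>i<n. x i * b ^ i) + x n * b ^ n = (\<Sum>i<n. y i * b ^ i) + y n * b ^ n"
    using Suc.prems(3) by simp
  have nz: "b ^ n \<noteq> 0" using lt(1) by linarith
  have "x n = ((\<Sum>i<n. x i * b ^ i) + x n * b ^ n) div b ^ n"
    by (simp only: div_mult_self1[OF nz] div_less[OF lt(1)] add_0_right)
  also have "\<dots> = y n"
    unfolding eq by (simp only: div_mult_self1[OF nz] div_less[OF lt(2)] add_0_right)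
  finally have "x n = y n" .
  then show ?case using Suc eq by (cases "i = n") auto
qed simp

text \<open>The step \<open>k\<close> makes sums of powers of \<open>b\<close> over subsets of a
  window equal to \<open>b ^ e\<close> times numbers with digits 0 and 1 in base
  \<open>b ^ k\<close>.\<close>

definition window :: "nat \<Rightarrow> nat \<Rightarrow> nat \<Rightarrow> nat set" where
  "window k e r = (\<lambda>a. e + k * a) ` {..<r}"

lemma finite_window [simp]: "finite (window k e r)"
  by (simp add: window_def)

lemma card_window [simp]: "k > 0 \<Longrightarrow> card (window k e r) = r"
  unfolding window_def by (subst card_image) (auto simp: inj_on_def)

lemma window_sum_diff:
  assumes "b \<ge> 2" "k > 0" "S \<subseteq> window k e r" "T \<subseteq> window k e r" "S \<noteq> T"
  shows "\<exists>z::int. z \<noteq> 0 \<and> \<bar>z\<bar> \<le> int ((b ^ k) ^ r) \<and>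
    (\<Sum>i\<in>S. real b ^ i) - (\<Sum>i\<in>T. real b ^ i) = real b ^ e * of_int z"
proof -
  define x where "x S a = (if e + k * a \<in> S then 1 else 0 :: nat)" for S a
  define v where "v S = (\<Sum>a<r. x S a * (b ^ k) ^ a)" for S
  have sum_eq: "(\<Sum>i\<in>S. real b ^ i) = real b ^ e * real (v S)" if "S \<subseteq> window k e r" for S
  proof -
    have "S = (\<lambda>a. e + k * a) ` {a. a < r \<and> e + k * a \<in> S}"
      using that by (auto simp: window_def)
    then have "(\<Sum>i\<in>S. real b ^ i) = (\<Sum>i\<in>(\<lambda>a. e + k * a) ` {a. a < r \<and> e + k * a \<in> S}. real b ^ i)"
      by simp
    also have "\<dots> = (\<Sum>a | a < r \<and> e + k * a \<in> S. real b ^ (e + k * a))"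
      using assms(2) by (subst sum.reindex) (auto simp: inj_on_def)
    also have "\<dots> = (\<Sum>a<r. if e + k * a \<in> S then real b ^ (e + k * a) else 0)"
      by (simp add: sum.inter_filter[symmetric])
    also have "\<dots> = real b ^ e * real (v S)"
      by (auto simp: v_def x_def sum_distrib_left power_add power_mult intro!: sum.cong)
    finally show ?thesis .
  qed
  have base: "2 \<le> b ^ k" using assms(1,2) self_le_power[of b k] by simp
  have x: "x S a < b ^ k" for S a using base assms(1) by (simp add: x_def)
  have "v S \<noteq> v T"
  proof
    assume "v S = v T"
    then have xeq: "x S a = x T a" if "a < r" for a
      using digit_sum_inj[of r "x S" "b ^ k" "x T" a] x that by (simp add: v_def)
    then have "e + k * a \<in> S \<longleftrightarrow> e + k * a \<in> T" if "a < r" for a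
      using xeq[OF that] by (simp add: x_def split: if_splits)
    then have "S = T" using assms(3,4) by (fastforce simp: window_def)
    then show False using assms(5) by simp
  qed
  then have "int (v S) - int (v T) \<noteq> 0" by simp
  moreover have "v S < (b ^ k) ^ r" "v T < (b ^ k) ^ r"
    unfolding v_def using x by (intro digit_sum_less, simp)+
  then have "\<bar>int (v S) - int (v T)\<bar> \<le> int ((b ^ k) ^ r)" by linarith
  moreover have "(\<Sum>i\<in>S. real b ^ i) - (\<Sum>i\<in>T. real b ^ i) = real b ^ e * of_int (int (v S) - int (v T))"
    by (simp add: sum_eq assms(3,4) right_diff_distrib)
  ultimately show ?thesis by blast
qed

text \<open>The loss \<open>1 / 2 ^ card I\<close> is the contribution of the diagonal \<open>S = T\<close>.\<close>

lemma diff_avg_peel: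
  assumes "finite I" "I \<noteq> {}" "\<forall>J\<in>set Is. finite J" "\<epsilon> \<ge> 0" "diff_avg g (I # Is) c \<ge> \<epsilon> + 1 / 2 ^ card I"
  shows "\<exists>S T. S \<subseteq> I \<and> T \<subseteq> I \<and> S \<noteq> T \<and> diff_avg g Is (c * (sum g S - sum g T)) \<ge> \<epsilon>"
proof (rule ccontr)
  assume "\<not> ?thesis"
  then have less: "diff_avg g Is (c * (sum g S - sum g T)) < \<epsilon>" if "S \<subseteq> I" "T \<subseteq> I" "S \<noteq> T" for S T
    using that not_le by blast
  have le: "diff_avg g Is (c * (sum g S - sum g T)) \<le> \<epsilon> + of_bool (S = T)" if "S \<subseteq> I" "T \<subseteq> I" for S T
    using less[of S T] that diff_avg_le_1[OF assms(3), of g "c * (sum g S - sum g T)"] assms(4)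
    by (cases "S = T") (simp_all del: diff_self)
  have "(\<Sum>z\<in>Pow I \<times> Pow I. diff_avg g Is (c * (sum g (fst z) - sum g (snd z))))
      < (\<Sum>z\<in>Pow I \<times> Pow I. \<epsilon> + of_bool (fst z = snd z))"
  \<comment> \<open>The inequality is strict at the pair of the empty set and \<open>I\<close>,
    which differ as \<open>I\<close> is nonempty.\<close>
  proof (rule sum_strict_mono_ex1)
    show "\<exists>z\<in>Pow I \<times> Pow I. diff_avg g Is (c * (sum g (fst z) - sum g (snd z))) < \<epsilon> + of_bool (fst z = snd z)"
      using less[of "{}" I] assms(2) by (intro bexI[of _ "({}, I)"]) auto
  qed (use assms(1) le in auto)
  also have "\<dots> = (\<Sum>S\<in>Pow I. \<Sum>T\<in>Pow I. \<epsilon> + of_bool (S = T))"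
    by (simp add: sum.cartesian_product case_prod_beta)
  also have "\<dots> = (\<Sum>S\<in>Pow I. 2 ^ card I * \<epsilon> + 1)"
    using assms(1) by (intro sum.cong) (auto simp: sum.distrib card_Pow of_bool_def)
  also have "\<dots> = 4 ^ card I * (\<epsilon> + 1 / 2 ^ card I)"
  proof -
    have "(4::real) ^ card I = 2 ^ card I * 2 ^ card I" by (simp flip: power_mult_distrib)
    then show ?thesis using assms(1) by (simp add: card_Pow field_simps)
  qed
  also have "\<dots> \<le> 4 ^ card I * diff_avg g (I # Is) c"
    using assms(5) by (intro mult_left_mono) auto
  also have "\<dots> = (\<Sum>z\<in>Pow I \<times> Pow I. diff_avg g Is (c * (sum g (fst z) - sum g (snd z))))"
    by (simp add: sum.cartesian_product case_prod_beta)
  finally show False by simp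
qed

text \<open>Each window peeled off costs \<open>1 / 2 ^ r\<close> and puts \<open>b ^ e\<close> and
  a nonzero integer of size at most \<open>(b ^ k) ^ r\<close> into the coefficient.\<close>

lemma diff_avg_peel_windows:
  assumes "b \<ge> 2" "k > 0" "r > 0" "\<forall>J\<in>set Js. finite J" "\<epsilon> \<ge> 0"
    and "diff_avg (\<lambda>i. real b ^ i) (map (\<lambda>e. window k e r) es @ Js) c \<ge> \<epsilon> + real (length es) / 2 ^ r"
  shows "\<exists>z::int. z \<noteq> 0 \<and> \<bar>z\<bar> \<le> int ((b ^ k) ^ (r * length es)) \<and>
    diff_avg (\<lambda>i. real b ^ i) Js (c * real b ^ sum_list es * of_int z) \<ge> \<epsilon>"
  using assms(6)
proof (induction es arbitrary: c)
  case Nil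
  then show ?case by (intro exI[of _ 1]) auto
next
  case (Cons e es)
  let ?g = "\<lambda>i. real b ^ i"
  have ne: "window k e r \<noteq> {}" using assms(3) by (auto simp: window_def)
  have fin: "\<forall>J\<in>set (map (\<lambda>e. window k e r) es @ Js). finite J" using assms(4) by auto
  have nn: "0 \<le> \<epsilon> + real (length es) / 2 ^ r" using assms(5) by simp
  have "\<epsilon> + real (length (e # es)) / 2 ^ r = (\<epsilon> + real (length es) / 2 ^ r) + 1 / 2 ^ card (window k e r)"
    using assms(2) by (simp add: field_simps)
  with Cons.prems have le: "(\<epsilon> + real (length es) / 2 ^ r) + 1 / 2 ^ card (window k e r)
      \<le> diff_avg ?g (window k e r # (map (\<lambda>e. window k e r) es @ Js)) c"
    by simp
  obtain S T where ST: "S \<subseteq> window k e r" "T \<subseteq> window k e r" "S \<noteq> T"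
    "diff_avg ?g (map (\<lambda>e. window k e r) es @ Js) (c * (sum ?g S - sum ?g T)) \<ge> \<epsilon> + real (length es) / 2 ^ r"
    using diff_avg_peel[OF finite_window ne fin nn le] by (elim exE conjE) (rule that)
  obtain y :: int where y: "y \<noteq> 0" "\<bar>y\<bar> \<le> int ((b ^ k) ^ r)" "sum ?g S - sum ?g T = real b ^ e * of_int y"
    using window_sum_diff[OF assms(1,2) ST(1-3)] by blast
  obtain z :: int where z: "z \<noteq> 0" "\<bar>z\<bar> \<le> int ((b ^ k) ^ (r * length es))"
    "diff_avg ?g Js (c * (sum ?g S - sum ?g T) * real b ^ sum_list es * of_int z) \<ge> \<epsilon>"
    using Cons.IH[OF ST(4)] by blast
  have "\<bar>y * z\<bar> \<le> int ((b ^ k) ^ (r * length (e # es)))"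
    using mult_mono[OF y(2) z(2)] by (simp add: abs_mult power_add)
  then show ?case using y z
    by (intro exI[of _ "y * z"]) (auto simp: power_add mult_ac)
qed

text \<open>If the points \<open>\<beta> S\<close> were separated,
  \<open>separated_cos_prod_bound\<close> would keep the sum of \<open>h\<close>-th powers of
  \<open>P\<close> below what the large average forces. So two of them are close, and their
  difference is again a window difference.\<close>

lemma window_pair_approx:
  fixes h :: nat
  assumes "b \<ge> 2" "k > 0" "0 < \<eta>" "h > 0"
    and large: "(1 + 4 * real (b ^ k) * (1 - 1 / (16 * (real (b ^ k))\<^sup>2)) ^ h) ^ r < 2 ^ s * \<eta> ^ Suc h"
    and avg: "diff_avg (\<lambda>i. real b ^ i) [window k e s, window k e' r] c \<ge> 2 * \<eta>"
  shows "\<exists>z::int. z \<noteq> 0 \<and> \<bar>z\<bar> \<le> int ((b ^ k) ^ s) \<and>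
    dist_int (c * real b ^ (e + e') * of_int z) \<le> 1 / (2 * real (b ^ k) ^ r)"
proof -
  define g where "g i = real b ^ i" for i
  define D where "D = b ^ k"
  define I where "I = window k e s"
  define P where "P x = diff_avg g [window k e' r] x" for x
  have D: "D > 0" using assms(1) by (simp add: D_def)
  have I: "finite I" "card I = s" using assms(2) by (auto simp: I_def)
  have P_eq: "P x = (\<Prod>a<r. (cos (pi * (x * real b ^ e' * real D ^ a)))\<^sup>2)" for x
  proof -
    have "P x = (\<Prod>i\<in>(\<lambda>a. e' + k * a) ` {..<r}. (cos (pi * (x * g i)))\<^sup>2)"
      unfolding P_def by (subst diff_avg_single) (auto simp: window_def)
    also have "\<dots> = (\<Prod>a<r. (cos (pi * (x * g (e' + k * a))))\<^sup>2)"
      using assms(2) by (subst prod.reindex) (auto simp: inj_on_def)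
    finally show ?thesis by (simp add: g_def D_def power_add power_mult mult.assoc)
  qed
  have P: "0 \<le> P x" "P x \<le> 1" for x
    unfolding P_eq by (auto intro!: prod_nonneg prod_le_1 simp: abs_square_le_1)
  \<comment> \<open>Fixing a good \<open>T\<close> leaves a family indexed by \<open>S\<close>
    alone; \<open>T\<close> cancels in \<open>\<beta> S - \<beta> S'\<close>.\<close>
  have "\<exists>T\<in>Pow I. (\<Sum>S\<in>Pow I. P (c * (sum g S - sum g T))) \<ge> 2 ^ s * (2 * \<eta>)"
  proof (rule ccontr)
    assume "\<not> ?thesis"
    then have "(\<Sum>T\<in>Pow I. \<Sum>S\<in>Pow I. P (c * (sum g S - sum g T))) < (\<Sum>T\<in>Pow I. 2 ^ s * (2 * \<eta>))"
      using I by (intro sum_strict_mono) (auto simp: not_le)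
    also have "\<dots> = 4 ^ s * (2 * \<eta>)"
      using I by (simp add: card_Pow power_mult_distrib[symmetric] mult.assoc[symmetric])
    also have "\<dots> \<le> 4 ^ s * diff_avg g [I, window k e' r] c"
      using avg unfolding g_def[abs_def] I_def by (rule mult_left_mono) simp
    also have "\<dots> = (\<Sum>S\<in>Pow I. \<Sum>T\<in>Pow I. P (c * (sum g S - sum g T)))"
      using I by (simp add: P_def)
    finally show False by (subst (asm) sum.swap) simp
  qed
  then obtain T where T: "(\<Sum>S\<in>Pow I. P (c * (sum g S - sum g T))) \<ge> 2 ^ s * (2 * \<eta>)" by blast
  define \<beta> where "\<beta> S = c * (sum g S - sum g T) * real b ^ e'" for S
  \<comment> \<open>Passes from the mean of \<open>P\<close> to its \<open>h\<close>-th moment: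
    values up to \<open>\<eta>\<close> account for at most half of the lower bound with
    \<open>2 * \<eta>\<close>, and for larger values \<open>\<eta> ^ h\<close> is below
    \<open>P x ^ h\<close>.\<close>
  have P_le: "\<eta> ^ h * P x \<le> \<eta> ^ h * \<eta> + P x ^ h" for x
  proof (cases "P x \<le> \<eta>")
    case True
    then show ?thesis using P assms(3) by (intro add_increasing2 mult_left_mono) auto
  next
    case False
    have "\<eta> ^ h * P x \<le> P x ^ h * 1" using False P assms(3) by (intro mult_mono power_mono) auto
    then show ?thesis using assms(3) by (intro add_increasing) auto
  qed
  have "2 ^ s * (2 * \<eta>) * \<eta> ^ h \<le> (\<Sum>S\<in>Pow I. \<eta> ^ h * P (c * (sum g S - sum g T)))"
    using mult_left_mono[OF T, of "\<eta> ^ h"] assms(3) by (simp add: sum_distrib_left mult_ac)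
  also have "\<dots> \<le> (\<Sum>S\<in>Pow I. \<eta> ^ h * \<eta> + P (c * (sum g S - sum g T)) ^ h)"
    by (intro sum_mono P_le)
  also have "\<dots> = 2 ^ s * \<eta> ^ Suc h + (\<Sum>S\<in>Pow I. P (c * (sum g S - sum g T)) ^ h)"
    using I by (simp add: sum.distrib card_Pow)
  finally have "2 ^ s * \<eta> ^ Suc h \<le> (\<Sum>S\<in>Pow I. (\<Prod>a<r. (cos (pi * (\<beta> S * real D ^ a)))\<^sup>2) ^ h)"
    by (simp add: P_eq \<beta>_def mult_ac)
  then have "\<not> (\<Sum>S\<in>Pow I. (\<Prod>a<r. (cos (pi * (\<beta> S * real D ^ a)))\<^sup>2) ^ h)
      \<le> (1 + 4 * real D * (1 - 1 / (16 * (real D)\<^sup>2)) ^ h) ^ r"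
    using large by (simp add: D_def)
  then have "\<exists>S S'. S \<subseteq> I \<and> S' \<subseteq> I \<and> S \<noteq> S' \<and> dist_int (\<beta> S - \<beta> S') \<le> 1 / (2 * real D ^ r)"
    using separated_cos_prod_bound[where X = "Pow I" and D = D and \<beta> = \<beta> and r = r and h = h] I D
    by (meson Pow_iff finite_Pow_iff not_less)
  then obtain S S' where S: "S \<subseteq> I" "S' \<subseteq> I" "S \<noteq> S'" "dist_int (\<beta> S - \<beta> S') \<le> 1 / (2 * real D ^ r)"
    by blast
  obtain z :: int where z: "z \<noteq> 0" "\<bar>z\<bar> \<le> int ((b ^ k) ^ s)" "sum g S - sum g S' = real b ^ e * of_int z"
    using window_sum_diff[OF assms(1,2), of S e s S'] S(1-3) by (auto simp: I_def g_def[abs_def])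
  have "\<beta> S - \<beta> S' = c * (sum g S - sum g S') * real b ^ e'"
    by (simp add: \<beta>_def algebra_simps)
  also have "\<dots> = c * real b ^ (e + e') * of_int z"
    by (simp add: z(3) power_add mult_ac)
  finally show ?thesis using S(4) z by (auto simp: D_def)
qed

subsection \<open>Approximation for all shifts\<close>

text \<open>Expansions with digits below \<open>b\<close> are unique and \<open>k\<close>-th powers
  of naturals are distinct, so each of the \<open>2 ^ n\<close> digit strings carries its own mass;
  \<open>S\<close> is the set of positions with digit \<open>d2\<close>.\<close>

lemma mu_hat_eq:
  assumes "k > 0" "b > d1" "b > d2" "d1 \<noteq> d2"
  shows "mu_hat k b d1 d2 n \<theta> = (\<Sum>S\<in>Pow {..<n}. exp2pi (\<theta> * (real d1 * (\<Sum>i<n. real b ^ i)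
    + (real d2 - real d1) * (\<Sum>i\<in>S. real b ^ i)) ^ k)) / 2 ^ n"
proof -
  define digit where "digit S i = (if i \<in> S then d2 else d1)" for S and i :: nat
  define val where "val S = (\<Sum>i<n. digit S i * b ^ i)" for S
  define M where "M = (\<lambda>S. int (val S ^ k)) ` Pow {..<n}"
  have val_real: "real (val S) = real d1 * (\<Sum>i<n. real b ^ i) + (real d2 - real d1) * (\<Sum>i\<in>S. real b ^ i)"
    if "S \<subseteq> {..<n}" for S
  proof -
    have "(\<Sum>i\<in>S. real b ^ i) = (\<Sum>i<n. if i \<in> S then real b ^ i else 0)"
      using that by (simp add: sum.inter_restrict[symmetric] Int_absorb1)
    then show ?thesis
      by (auto simp: val_def digit_def sum_distrib_left sum.distrib[symmetric] algebra_simps intro!: sum.cong)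
  qed
  have inj: "inj_on (\<lambda>S. int (val S ^ k)) (Pow {..<n})"
  proof (rule inj_onI)
    fix S T assume ST: "S \<in> Pow {..<n}" "T \<in> Pow {..<n}" "int (val S ^ k) = int (val T ^ k)"
    then have "val S ^ k = val T ^ k" by (simp only: of_nat_eq_iff)
    then have "val S = val T" using assms(1) by (simp add: power_eq_iff_eq_base)
    then have dig: "digit S i = digit T i" if "i < n" for i
      using digit_sum_inj[of n "digit S" b "digit T" i] that assms(2,3) by (simp add: val_def digit_def)
    have "i \<in> S \<longleftrightarrow> i \<in> T" if "i < n" for i
      using dig[OF that] assms(4) by (simp add: digit_def split: if_splits)
    then show "S = T" using ST(1,2) by blast
  qed
  have mem: "(\<exists>x :: nat \<Rightarrow> nat. (\<forall>i<n. x i \<in> {d1, d2}) \<and> m = int ((\<Sum>i<n. x i * b ^ i) ^ k)) \<longleftrightarrow> m \<in> M" for m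
  proof
    assume "\<exists>x :: nat \<Rightarrow> nat. (\<forall>i<n. x i \<in> {d1, d2}) \<and> m = int ((\<Sum>i<n. x i * b ^ i) ^ k)"
    then obtain x where x: "\<forall>i<n. x i \<in> {d1, d2}" "m = int ((\<Sum>i<n. x i * b ^ i) ^ k)" by blast
    have "val {i. i < n \<and> x i = d2} = (\<Sum>i<n. x i * b ^ i)"
      unfolding val_def using x(1) by (intro sum.cong) (auto simp: digit_def)
    then show "m \<in> M" unfolding M_def x(2) by (intro image_eqI[of _ _ "{i. i < n \<and> x i = d2}"]) auto
  next
    assume "m \<in> M"
    then obtain S where "m = int (val S ^ k)" by (auto simp: M_def)
    then show "\<exists>x :: nat \<Rightarrow> nat. (\<forall>i<n. x i \<in> {d1, d2}) \<and> m = int ((\<Sum>i<n. x i * b ^ i) ^ k)"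
      by (intro exI[of _ "digit S"]) (auto simp: val_def digit_def)
  qed
  have mu: "mu k b d1 d2 n m = (if m \<in> M then 1 / 2 ^ n else 0)" for m
    unfolding mu_def mem ..
  have "mu_hat k b d1 d2 n \<theta> = (\<Sum>\<^sub>\<infinity>m\<in>M. of_real (1 / 2 ^ n) * exp2pi (of_int m * \<theta>))"
    unfolding mu_hat_def by (intro infsum_cong_neutral) (auto simp: mu)
  also have "\<dots> = (\<Sum>m\<in>M. of_real (1 / 2 ^ n) * exp2pi (of_int m * \<theta>))"
    by (intro infsum_finite) (simp add: M_def)
  also have "\<dots> = (\<Sum>S\<in>Pow {..<n}. exp2pi (\<theta> * real (val S) ^ k)) / 2 ^ n"
    unfolding M_def sum.reindex[OF inj] by (simp add: sum_divide_distrib mult.commute)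
  also have "\<dots> = (\<Sum>S\<in>Pow {..<n}. exp2pi (\<theta> * (real d1 * (\<Sum>i<n. real b ^ i)
    + (real d2 - real d1) * (\<Sum>i\<in>S. real b ^ i)) ^ k)) / 2 ^ n"
    by (simp add: val_real)
  finally show ?thesis .
qed

text \<open>Serves to distribute a total shift among the \<open>k\<close> windows; the choice is
  greedy.\<close>

lemma exists_bounded_summands:
  fixes l :: nat
  assumes "l \<le> k * M"
  shows "\<exists>f. (\<forall>j. f j \<le> M) \<and> (\<Sum>j<k. f j) = l"
  using assms
proof (induction k arbitrary: l)
  case 0
  then show ?case by (intro exI[of _ "\<lambda>_. 0"]) auto
next
  case (Suc k)
  then have "l - min l M \<le> k * M" by auto
  then obtain f where f: "\<forall>j. f j \<le> M" "(\<Sum>j<k. f j) = l - min l M" using Suc.IH by blast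
  have "(\<Sum>j<k. (f(k := min l M)) j) = (\<Sum>j<k. f j)" by (intro sum.cong) auto
  then show ?case using f by (intro exI[of _ "f(k := min l M)"]) auto
qed

text \<open>After restriction to windows and differencing, all windows but the last two are peeled
  off, and \<open>window_pair_approx\<close> treats those two. Moving a window multiplies the
  coefficient by a power of \<open>b ^ k\<close>, which produces every shift
  \<open>l\<close>.\<close>

lemma shift_approx:
  fixes \<theta> \<delta> \<eta> t0 d :: real
  assumes "k \<ge> 2" "b \<ge> 2" "0 < s" "s \<le> r" "r \<le> m" "0 < \<delta>" "0 < \<eta>" "h > 0"
    and avg: "\<delta> \<le> norm ((\<Sum>S\<in>Pow {..<k * m}. exp2pi (\<theta> * (t0 + d * (\<Sum>i\<in>S. real b ^ i)) ^ k)) / 2 ^ (k * m))"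
    and \<eta>: "2 * \<eta> + real (k - 2) / 2 ^ s \<le> \<delta> ^ 2 ^ k"
    and large: "(1 + 4 * real (b ^ k) * (1 - 1 / (16 * (real (b ^ k))\<^sup>2)) ^ h) ^ r < 2 ^ s * \<eta> ^ Suc h"
    and l: "l \<le> k * (m - r)"
  shows "\<exists>z::int. z \<noteq> 0 \<and> \<bar>z\<bar> \<le> int ((b ^ k) ^ (s * (k - 1))) \<and>
    dist_int (fact k * (\<theta> * d ^ k) * real b ^ (\<Sum>j<k. j) * real (b ^ k) ^ l * of_int z)
      \<le> 1 / (2 * real (b ^ k) ^ r)"
proof -
  define g where "g i = real b ^ i" for i
  define p where "p = k - 2"
  have k: "k = Suc (Suc p)" using assms(1) by (simp add: p_def)
  obtain ls where ls: "\<And>j. ls j \<le> m - r" "(\<Sum>j<k. ls j) = l"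
    using exists_bounded_summands[OF l] by blast
  \<comment> \<open>The starts are congruent to \<open>j\<close> modulo \<open>k\<close>, which
    makes the windows disjoint, and \<open>ls j \<le> m - r\<close> keeps even the long one below
    \<open>k * m\<close>.\<close>
  define e where "e j = j + k * ls j" for j
  define Ws where "Ws = map (\<lambda>j. window k (e j) (if j = Suc p then r else s)) [0..<k]"
  have Ws: "Ws = map (\<lambda>e. window k e s) (map e [0..<p]) @ [window k (e p) s, window k (e (Suc p)) r]"
    by (simp add: Ws_def k)
  have sub: "\<forall>W\<in>set Ws. W \<subseteq> {..<k * m}"
  proof
    fix W assume "W \<in> set Ws"
    then obtain j where j: "j < k" "W = window k (e j) (if j = Suc p then r else s)" by (auto simp: Ws_def)
    show "W \<subseteq> {..<k * m}"
    proof
      fix x assume "x \<in> W"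
      then have "x \<in> window k (e j) r"
        using j(2) assms(4) by (auto simp: window_def split: if_splits intro!: imageI)
      then obtain a where a: "a < r" "x = e j + k * a" by (auto simp: window_def)
      have "ls j + a + 1 \<le> m" using ls(1)[of j] a(1) assms(5) by linarith
      then have "k * (ls j + a + 1) \<le> k * m" by (rule mult_le_mono2)
      then show "x \<in> {..<k * m}" using j(1) a(2) by (simp add: e_def algebra_simps)
    qed
  qed
  have mod: "x mod k = j" if "x \<in> window k (e j) q" "j < k" for x j q
    using that by (auto simp: window_def e_def)
  have "sorted_wrt (\<lambda>i j. i < j \<and> j < k) [0..<k]"
    by (simp add: sorted_wrt_iff_nth_less)
  then have "sorted_wrt (\<lambda>i j. window k (e i) (if i = Suc p then r else s) \<inter>
      window k (e j) (if j = Suc p then r else s) = {}) [0..<k]"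
    by (rule sorted_wrt_mono_rel[rotated]) (metis disjoint_iff mod less_irrefl less_trans)
  then have disj: "sorted_wrt (\<lambda>V W. V \<inter> W = {}) Ws"
    by (simp add: Ws_def sorted_wrt_map)
  have "\<delta> \<le> norm ((\<Sum>S\<in>Pow {..<k * m}. exp2pi (\<theta> * (t0 + d * sum g S) ^ k)) / 2 ^ card {..<k * m})"
    using avg by (simp add: g_def)
  then obtain S where S: "\<delta> \<le> norm (cube_avg g Ws (\<lambda>t. exp2pi (\<theta> * (t0 + d * (sum g S + t)) ^ k)))"
    using restrict_to_windows[OF _ sub disj, of "\<lambda>t. exp2pi (\<theta> * (t0 + d * t) ^ k)" g]
    by (meson finite_lessThan order_trans)
  \<comment> \<open>The offset \<open>t0\<close> and the fixed digits \<open>S\<close> affect only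
    lower coefficients; the top one is \<open>\<theta> * d ^ k\<close>.\<close>
  define Q where "Q = smult \<theta> ([:t0 + d * sum g S, d:] ^ k)"
  have "poly Q t = \<theta> * (t0 + d * (sum g S + t)) ^ k" for t
    by (simp add: Q_def algebra_simps)
  with S have "\<delta> ^ 2 ^ k \<le> norm (cube_avg g Ws (\<lambda>t. exp2pi (poly Q t))) ^ 2 ^ k"
    using assms(6) by (intro power_mono) auto
  also have "\<dots> \<le> diff_avg g Ws (fact k * coeff Q k)"
  proof -
    have "degree Q \<le> k"
      unfolding Q_def by (rule order_trans[OF degree_smult_le], rule order_trans[OF degree_power_le]) simp
    moreover have "length Ws = k" "Ws \<noteq> []" by (simp_all add: Ws_def k)
    moreover have "\<forall>I\<in>set Ws. finite I" by (auto simp: Ws_def)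
    ultimately show ?thesis using iterated_Cauchy_Schwarz[of Ws Q g] by simp
  qed
  also have "coeff Q k = \<theta> * d ^ k" by (simp add: Q_def coeff_linear_poly_power)
  finally have "2 * \<eta> + real (length (map e [0..<p])) / 2 ^ s
      \<le> diff_avg g (map (\<lambda>e. window k e s) (map e [0..<p]) @ [window k (e p) s, window k (e (Suc p)) r])
          (fact k * (\<theta> * d ^ k))"
    using \<eta> unfolding Ws by (simp add: p_def)
  from diff_avg_peel_windows[OF assms(2) _ assms(3) _ _ this[unfolded g_def[abs_def]]] assms(7) k
  obtain y :: int where y: "y \<noteq> 0" "\<bar>y\<bar> \<le> int ((b ^ k) ^ (s * p))"
    "2 * \<eta> \<le> diff_avg (\<lambda>i. real b ^ i) [window k (e p) s, window k (e (Suc p)) r]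
       (fact k * (\<theta> * d ^ k) * real b ^ sum_list (map e [0..<p]) * of_int y)"
    by (auto simp del: diff_avg.simps)
  from window_pair_approx[OF assms(2) _ assms(7,8) large y(3)] k
  obtain z :: int where z: "z \<noteq> 0" "\<bar>z\<bar> \<le> int ((b ^ k) ^ s)"
    "dist_int (fact k * (\<theta> * d ^ k) * real b ^ sum_list (map e [0..<p]) * of_int y *
       real b ^ (e p + e (Suc p)) * of_int z) \<le> 1 / (2 * real (b ^ k) ^ r)"
    by auto
  have "\<bar>y * z\<bar> \<le> int ((b ^ k) ^ (s * p)) * int ((b ^ k) ^ s)"
    unfolding abs_mult by (intro mult_mono y(2) z(2)) auto
  also have "\<dots> = int ((b ^ k) ^ (s * (k - 1)))" by (simp add: k power_add)
  finally have bound: "\<bar>y * z\<bar> \<le> int ((b ^ k) ^ (s * (k - 1)))" .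
  have "sum_list (map e [0..<p]) + (e p + e (Suc p)) = (\<Sum>j<k. e j)"
    by (simp add: k interv_sum_list_conv_sum_set_nat atLeast0LessThan)
  also have "\<dots> = (\<Sum>j<k. j) + k * l"
    by (simp add: e_def sum.distrib ls(2) flip: sum_distrib_left)
  finally have exponent: "real b ^ sum_list (map e [0..<p]) * real b ^ (e p + e (Suc p))
      = real b ^ (\<Sum>j<k. j) * real (b ^ k) ^ l"
    by (simp add: power_add[symmetric] power_mult[symmetric])
  have "fact k * (\<theta> * d ^ k) * real b ^ sum_list (map e [0..<p]) * of_int y * real b ^ (e p + e (Suc p)) * of_int z
      = fact k * (\<theta> * d ^ k) * (real b ^ sum_list (map e [0..<p]) * real b ^ (e p + e (Suc p))) * of_int (y * z)"
    by (simp add: mult_ac)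
  also have "\<dots> = fact k * (\<theta> * d ^ k) * real b ^ (\<Sum>j<k. j) * real (b ^ k) ^ l * of_int (y * z)"
    unfolding exponent by (simp add: mult_ac)
  finally have eq: "fact k * (\<theta> * d ^ k) * real b ^ sum_list (map e [0..<p]) * of_int y * real b ^ (e p + e (Suc p)) * of_int z
      = fact k * (\<theta> * d ^ k) * real b ^ (\<Sum>j<k. j) * real (b ^ k) ^ l * of_int (y * z)" .
  have "y * z \<noteq> 0" using y(1) z(1) by simp
  then show ?thesis using bound z(3)[unfolded eq] by blast
qed

text \<open>Take \<open>q\<close> from shift 0 and let \<open>x\<close> be the deviation of
  \<open>c * q\<close>. Although \<open>z\<close> varies with \<open>l\<close>, the bound
  \<open>R\<^sup>2 * D < E\<close> keeps \<open>x * D ^ l * z\<close> within \<open>1 / 2\<close>,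
  so its absolute value is its distance to the integers. Modulo 1 it is \<open>q\<close> times a
  number close to an integer, which restores the bound \<open>R / (2 * E)\<close> at every
  step.\<close>

lemma approx_chain:
  fixes c R E :: real and D :: nat
  assumes "D > 0" "1 \<le> R" "R\<^sup>2 * real D < E"
    and approx: "\<And>l. l \<le> L \<Longrightarrow> \<exists>z::int. z \<noteq> 0 \<and> real_of_int \<bar>z\<bar> \<le> R \<and> dist_int (c * real D ^ l * of_int z) \<le> 1 / (2 * E)"
  shows "\<exists>q::nat. q > 0 \<and> real q \<le> R \<and> dist_int (c * real q) * real D ^ L \<le> R / (2 * E)"
proof -
  have E: "E > 0" using assms(3) zero_le_mult_iff[of "R\<^sup>2" "real D"] by (smt (verit) of_nat_0_le_iff zero_le_power2)
  obtain z0 :: int where z0: "z0 \<noteq> 0" "real_of_int \<bar>z0\<bar> \<le> R" "dist_int (c * of_int z0) \<le> 1 / (2 * E)"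
    using approx[of 0] by auto
  define q where "q = nat \<bar>z0\<bar>"
  have q: "q > 0" "real q \<le> R" using z0 by (auto simp: q_def)
  have "c * real q = c * of_int z0 \<or> c * real q = - (c * of_int z0)" by (auto simp: q_def abs_if)
  then have q_dist: "dist_int (c * real q) \<le> 1 / (2 * E)" using z0(3) dist_int_minus[of "c * of_int z0"] by auto
  define x where "x = c * real q - of_int (round (c * real q))"
  have "\<bar>x\<bar> * real D ^ l \<le> R / (2 * E)" if "l \<le> L" for l
    using that
  proof (induction l)
    case 0
    have "1 / (2 * E) \<le> R / (2 * E)" using assms(2) E by (intro divide_right_mono) auto
    then show ?case using q_dist by (simp add: x_def dist_int_def)
  next
    case (Suc l)
    define y where "y = x * real D ^ Suc l"
    obtain z :: int where z: "z \<noteq> 0" "real_of_int \<bar>z\<bar> \<le> R" "dist_int (c * real D ^ Suc l * of_int z) \<le> 1 / (2 * E)"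
      using approx[OF Suc.prems] by auto
    have "\<bar>y\<bar> = real D * (\<bar>x\<bar> * real D ^ l)" by (simp add: y_def abs_mult)
    also have "\<dots> \<le> real D * (R / (2 * E))" using Suc by (intro mult_left_mono) auto
    finally have "\<bar>y\<bar> \<le> real D * (R / (2 * E))" .
    then have "\<bar>y * of_int z\<bar> \<le> real D * (R / (2 * E)) * R"
      unfolding abs_mult using z(2) assms(2) E by (intro mult_mono) auto
    also have "\<dots> \<le> 1 / 2" using assms(3) E by (simp add: field_simps power2_eq_square)
    finally have small: "\<bar>y * of_int z\<bar> \<le> 1 / 2" .
    have yz: "y * of_int z = real q * (c * real D ^ Suc l * of_int z)
        + of_int (- round (c * real q) * int D ^ Suc l * z)"
      by (simp add: y_def x_def algebra_simps)
    have "\<bar>y\<bar> * real_of_int \<bar>z\<bar> = dist_int (y * of_int z)"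
      by (simp add: dist_int_eq_abs[OF small] abs_mult)
    also have "\<dots> = dist_int (real q * (c * real D ^ Suc l * of_int z))"
      unfolding yz by (rule dist_int_add_of_int)
    also have "\<dots> \<le> real q * dist_int (c * real D ^ Suc l * of_int z)"
      by (rule dist_int_mult_nat)
    also have "\<dots> \<le> R * (1 / (2 * E))"
      using q z(3) assms(2) dist_int_nonneg by (intro mult_mono) auto
    finally have "\<bar>y\<bar> * real_of_int \<bar>z\<bar> \<le> R / (2 * E)" by simp
    moreover have "\<bar>y\<bar> * 1 \<le> \<bar>y\<bar> * real_of_int \<bar>z\<bar>" using z(1) by (intro mult_left_mono) auto
    ultimately show ?case by (simp add: y_def abs_mult)
  qed
  from this[of L] show ?thesis using q by (intro exI[of _ q]) (simp add: x_def dist_int_def)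
qed

subsection \<open>Numerical estimates and conclusion\<close>

lemma mult_le_3_power:
  assumes "k \<ge> (2::nat)"
  shows "4 * k \<le> 3 ^ k" "2 * k\<^sup>2 \<le> 3 ^ k" "2 ^ Suc k \<le> (3::nat) ^ k"
  using assms
proof (induction k rule: dec_induct)
  case (step k)
  { case 1 then show ?case using step by simp }
  { case 2
    have "2 * (Suc k)\<^sup>2 \<le> 2 * k\<^sup>2 + 2 * (4 * k)" using step.hyps by (simp add: power2_eq_square)
    then show ?case using step.IH by simp }
  { case 3 then show ?case using step by simp }
qed (auto simp: power2_eq_square)

text \<open>The exponent \<open>16 * D ^ 4\<close> gives a nonzero digit weight at most
  \<open>exp (- D\<^sup>2)\<close>, hence at most \<open>4 / D ^ 4\<close>; over
  \<open>4 * D\<close> codes and \<open>4 * k \<le> D\<close> positions this totals at most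
  \<open>16 / D\<^sup>2\<close>. With \<open>r = 2 * k * s\<close>, the power \<open>4 * k\<close>
  later bounds the square of \<open>w ^ r\<close> by \<open>2 ^ s\<close>.\<close>

lemma pattern_weight_bound:
  assumes "k \<ge> 2" "D \<ge> 4 * k" "D \<ge> 9"
  shows "(1 + 4 * real D * (1 - 1 / (16 * (real D)\<^sup>2)) ^ (16 * D ^ 4)) ^ (4 * k) \<le> 2"
proof -
  define lam where "lam = 1 - 1 / (16 * (real D)\<^sup>2)"
  have D: "real D \<ge> 9" using assms(3) by simp
  have sq: "(real D)\<^sup>2 \<ge> 81" using power_mono[OF D, of 2] by simp
  have lam0: "0 \<le> lam" unfolding lam_def using assms(3) by (intro digit_weight_nonneg) simp
  have "lam \<le> exp (- (1 / (16 * (real D)\<^sup>2)))"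
    unfolding lam_def using exp_ge_add_one_self[of "- (1 / (16 * (real D)\<^sup>2))"] by simp
  then have "lam ^ (16 * D ^ 4) \<le> exp (- (1 / (16 * (real D)\<^sup>2))) ^ (16 * D ^ 4)"
    using lam0 by (intro power_mono)
  also have "\<dots> = exp (- (real D)\<^sup>2)"
  proof -
    have "real (16 * D ^ 4) * (- (1 / (16 * (real D)\<^sup>2))) = - (real D)\<^sup>2"
      using D by (simp add: field_simps power2_eq_square power4_eq_xxxx)
    then show ?thesis by (simp only: exp_of_nat_mult[symmetric])
  qed
  also have "\<dots> = 1 / (exp ((real D)\<^sup>2 / 2))\<^sup>2"
    by (simp add: exp_minus field_simps flip: exp_double)
  also have "\<dots> \<le> 1 / ((real D)\<^sup>2 / 2)\<^sup>2"
  proof -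
    have "(real D)\<^sup>2 / 2 \<le> exp ((real D)\<^sup>2 / 2)"
      using exp_ge_add_one_self[of "(real D)\<^sup>2 / 2"] by linarith
    then show ?thesis using assms(3) by (intro frac_le power_mono) auto
  qed
  also have "\<dots> = 4 / ((real D)\<^sup>2 * (real D)\<^sup>2)" by (simp add: power2_eq_square)
  finally have weight: "4 * real D * lam ^ (16 * D ^ 4) \<le> 4 * real D * (4 / ((real D)\<^sup>2 * (real D)\<^sup>2))"
    by (intro mult_left_mono) auto
  have "4 * real D * lam ^ (16 * D ^ 4) * real (4 * k) \<le> 4 * real D * (4 / ((real D)\<^sup>2 * (real D)\<^sup>2)) * real D"
    using assms(2) by (intro mult_mono[OF weight]) (simp only: of_nat_le_iff, simp_all)
  also have "\<dots> = 16 / (real D)\<^sup>2" using D by (simp add: field_simps power2_eq_square)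
  also have "\<dots> \<le> 1 / 2" using frac_le[of 16 16 81 "(real D)\<^sup>2"] sq by simp
  finally have small: "real (4 * k) * (4 * real D * lam ^ (16 * D ^ 4)) \<le> 1 / 2" by (simp add: mult_ac)
  have "(1 + 4 * real D * lam ^ (16 * D ^ 4)) ^ (4 * k) \<le> exp (4 * real D * lam ^ (16 * D ^ 4)) ^ (4 * k)"
    using lam0 by (intro power_mono exp_ge_add_one_self) auto
  also have "\<dots> = exp (real (4 * k) * (4 * real D * lam ^ (16 * D ^ 4)))"
    by (simp only: exp_of_nat_mult[symmetric])
  also have "\<dots> \<le> exp (1 / 2)" using small by (simp only: exp_le_cancel_iff)
  also have "\<dots> \<le> 2"
  proof (rule power2_le_imp_le)
    show "(exp (1 / 2 :: real))\<^sup>2 \<le> 2\<^sup>2" using exp_le by (simp flip: exp_double)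
  qed simp
  finally show ?thesis by (simp add: lam_def)
qed

lemma exists_power_of_2_between:
  fixes y :: real
  assumes "1 < y"
  shows "\<exists>s>0. y \<le> 2 ^ s \<and> 2 ^ s \<le> 2 * y"
proof -
  define s where "s = nat \<lceil>log 2 y\<rceil>"
  have pos: "log 2 y > 0" using assms by simp
  then have s: "log 2 y \<le> real s" "real s \<le> log 2 y + 1" unfolding s_def by linarith+
  have "y = 2 powr log 2 y" using assms by simp
  also have "\<dots> \<le> 2 powr real s" using s by simp
  finally have 1: "y \<le> 2 ^ s" by (simp add: powr_realpow)
  have "2 powr real s \<le> 2 powr (log 2 y + 1)" using s by simp
  also have "\<dots> = 2 * y" using assms by (simp add: powr_add)
  finally have "2 ^ s \<le> 2 * y" by (simp add: powr_realpow)
  then show ?thesis using 1 s pos by (intro exI[of _ s]) auto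
qed

theorem proposition2p1:
  fixes k b d1 d2 n B N :: nat and \<delta> \<theta> :: real
  assumes "k \<ge> 2" and "b \<ge> 3"
    and "d1 \<in> {0..b - 1}" and "d2 \<in> {0..b - 1}" and "d1 \<noteq> d2" and "coprime d1 d2"
    and "B = b ^ (6 * k\<^sup>2)"
    and "n > 0" and "k dvd n" and "N = b ^ n"
    and "0 < \<delta>" and "\<delta> < 1"
    and "norm (mu_hat k b d1 d2 n \<theta>) \<ge> \<delta>"
    and "real N \<ge> (2 / \<delta>) ^ B"
  shows "\<exists>q::nat. q > 0 \<and> real q \<le> (2 / \<delta>) ^ B \<and>
           dist_int (\<theta> * real q) \<le> (2 / \<delta>) ^ B / real N ^ k"
proof -
  define D where "D = b ^ k"
  define X where "X = 2 / \<delta>"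
  define h where "h = 16 * D ^ 4"
  \<comment> \<open>Makes \<open>X ^ E\<close> equal to \<open>A ^ (2 * (h + 2))\<close>, so that
    \<open>2 ^ s\<close> exceeds the square of \<open>A ^ Suc h\<close>.\<close>
  define E where "E = 2 ^ k * (2 * (h + 2))"
  \<comment> \<open>A quarter, so that \<open>2 * \<eta>\<close> and a peeling loss of at most
    \<open>1 / A \<le> \<eta>\<close> fit into \<open>\<delta> ^ 2 ^ k\<close>.\<close>
  define \<eta> where "\<eta> = \<delta> ^ 2 ^ k / 4"
  define A where "A = X ^ 2 ^ k"
  define d where "d = real d2 - real d1"
  define sh where "sh = (\<Sum>j<k. j)"
  obtain m where m: "n = k * m" using assms(9) by (auto elim: dvdE)
  have X: "X > 2" using assms(11,12) by (simp add: X_def field_simps)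
  have "(3::nat) ^ k \<le> D" unfolding D_def using assms(2) by (intro power_mono) auto
  then have D: "4 * k \<le> D" "2 * k\<^sup>2 \<le> D" "2 ^ Suc k \<le> D"
    using mult_le_3_power[OF assms(1)] by linarith+
  have "(3::nat) ^ 2 \<le> b ^ k" using assms(1,2) power_mono[of 3 b 2] power_increasing[of 2 k b] by linarith
  then have D9: "9 \<le> D" by (simp add: D_def)
  have A: "A > 1" unfolding A_def using X by (intro one_less_power) auto
  have XE: "X ^ E = A ^ (2 * (h + 2))" by (simp only: E_def A_def power_mult)
  \<comment> \<open>\<open>s\<close> is the length of the first \<open>k - 1\<close> windows and \<open>r\<close> that of the last one. The exponent \<open>h\<close>
    makes a nonzero digit weigh so little that there are fewer than \<open>2 ^ s\<close> weighted digit patterns of length \<open>r\<close>,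
    although \<open>r = 2 * k * s\<close> is large enough for \<open>D ^ r\<close> to beat all denominators, which are at most \<open>D ^ (s * (k - 1))\<close>.\<close>
  obtain s where s: "s > 0" "X ^ E \<le> 2 ^ s" "2 ^ s \<le> 2 * X ^ E"
    using exists_power_of_2_between[of "X ^ E"] X by (auto simp: E_def)
  define r where "r = 2 * k * s"
  have \<eta>: "0 < \<eta>" "1 / A \<le> \<eta>"
  proof -
    show "0 < \<eta>" using assms(11) by (simp add: \<eta>_def)
    have "(2::real) ^ 2 \<le> 2 ^ 2 ^ k" using assms(1) power_increasing[of 1 k "2::nat"] by (intro power_increasing) auto
    then have "1 / 2 ^ 2 ^ k \<le> (1 / 4 :: real)" by (intro frac_le) auto
    then have "\<delta> ^ 2 ^ k * (1 / 2 ^ 2 ^ k) \<le> \<delta> ^ 2 ^ k * (1 / 4)"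
      using assms(11) by (intro mult_left_mono) auto
    then show "1 / A \<le> \<eta>" by (simp add: A_def X_def \<eta>_def power_divide)
  qed
  have peel_loss: "2 * \<eta> + real (k - 2) / 2 ^ s \<le> \<delta> ^ 2 ^ k"
  proof -
    have "real (k - 2) \<le> real (2 ^ k)" using less_exp[of k] by (simp only: of_nat_le_iff)
    also have "\<dots> \<le> A"
    proof -
      have "(2::real) ^ k \<le> X ^ k" using X by (intro power_mono) auto
      also have "\<dots> \<le> A" unfolding A_def using X less_exp[of k] by (intro power_increasing) auto
      finally show ?thesis by simp
    qed
    finally have "real (k - 2) / 2 ^ s \<le> A / A ^ 2"
    proof (rule frac_le[rotated])
      have "A ^ 2 \<le> A ^ (2 * (h + 2))" using A by (intro power_increasing) auto
      then show "A ^ 2 \<le> 2 ^ s" using s(2) XE by simp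
    qed (use A in auto)
    also have "\<dots> = 1 / A" using A by (simp add: power2_eq_square)
    finally show ?thesis using \<eta> by (simp add: \<eta>_def)
  qed
  define w where "w = 1 + 4 * real D * (1 - 1 / (16 * (real D)\<^sup>2)) ^ h"
  \<comment> \<open>Both \<open>w ^ r\<close> and \<open>A ^ Suc h\<close> have square at most
    \<open>2 ^ s\<close>, the second strictly, so their product is below
    \<open>2 ^ s\<close>.\<close>
  have large: "w ^ r < 2 ^ s * \<eta> ^ Suc h"
  proof -
    have "w ^ (4 * k) \<le> 2" unfolding w_def h_def using assms(1) D(1) D9 by (rule pattern_weight_bound)
    moreover have "w \<ge> 0"
      unfolding w_def using D9
      by (intro add_nonneg_nonneg mult_nonneg_nonneg zero_le_power digit_weight_nonneg) auto
    ultimately have "(w ^ (4 * k)) ^ s \<le> 2 ^ s" by (intro power_mono) auto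
    then have w2: "(w ^ r)\<^sup>2 \<le> 2 ^ s" by (simp add: r_def power_mult[symmetric] mult_ac)
    have "(A ^ Suc h)\<^sup>2 < A ^ (2 * (h + 2))"
      unfolding power_mult[symmetric] using A by (intro power_strict_increasing) auto
    also have "\<dots> \<le> 2 ^ s" using s(2) XE by simp
    finally have "2 ^ s * (A ^ Suc h)\<^sup>2 < 2 ^ s * 2 ^ s" by simp
    moreover have "(w ^ r)\<^sup>2 * (A ^ Suc h)\<^sup>2 \<le> 2 ^ s * (A ^ Suc h)\<^sup>2"
      using w2 by (rule mult_right_mono) simp
    ultimately have "(w ^ r)\<^sup>2 * (A ^ Suc h)\<^sup>2 < 2 ^ s * 2 ^ s" by linarith
    then have "(w ^ r * A ^ Suc h)\<^sup>2 < (2 ^ s)\<^sup>2" by (simp add: power2_eq_square mult_ac)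
    then have "w ^ r * A ^ Suc h < 2 ^ s" by (rule power2_less_imp_less) simp
    then have "w ^ r < 2 ^ s * (1 / A) ^ Suc h" using A by (simp add: field_simps)
    also have "\<dots> \<le> 2 ^ s * \<eta> ^ Suc h" using \<eta> A by (intro mult_left_mono power_mono) auto
    finally show ?thesis .
  qed
  \<comment> \<open>Later losses are compared with \<open>D ^ (s * D)\<close>. From
    \<open>D < 2 ^ D\<close> and \<open>2 ^ s \<le> X ^ (E + 1)\<close> the exponent of
    \<open>X\<close> is at most \<open>D ^ 9 = b ^ (9 * k)\<close>, and
    \<open>9 * k \<le> 6 * k\<^sup>2\<close> as \<open>k \<ge> 2\<close>.\<close>
  have DB: "real D ^ (s * D) \<le> X ^ B"
  proof -
    have "real D ^ (s * D) \<le> (2 ^ D) ^ (s * D)"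
      using less_exp[of D] by (intro power_mono) (auto simp: less_imp_le)
    also have "\<dots> = (2 ^ s) ^ D\<^sup>2" by (simp add: power_mult[symmetric] power2_eq_square mult_ac)
    also have "\<dots> \<le> (X ^ (E + 1)) ^ D\<^sup>2"
    proof (rule power_mono)
      have "2 * X ^ E \<le> X * X ^ E" using X by (intro mult_right_mono) auto
      then show "2 ^ s \<le> X ^ (E + 1)" using s(3) by simp
    qed simp
    also have "\<dots> = X ^ ((E + 1) * D\<^sup>2)" by (simp only: power_mult)
    also have "\<dots> \<le> X ^ B"
    proof (rule power_increasing)
      have E: "E = 2 ^ Suc k * (16 * D ^ 4 + 2)" by (simp add: E_def h_def)
      have "E \<le> D * (16 * D ^ 4 + 2)" unfolding E by (intro mult_right_mono D) auto
      also have "\<dots> = 16 * (D * D ^ 4) + 2 * D" by (simp add: algebra_simps)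
      also have "D * D ^ 4 = D ^ 5" by (simp add: eval_nat_numeral)
      finally have "E \<le> 16 * D ^ 5 + 2 * D" .
      moreover have "D \<le> D ^ 5" "1 \<le> D ^ 5" using D9 by (auto intro: self_le_power)
      ultimately have "E + 1 \<le> 19 * D ^ 5" by linarith
      also have "\<dots> \<le> (D * D) * D ^ 5" using D9 mult_mono[of 9 D 9 D] by (intro mult_right_mono) auto
      finally have "(E + 1) * D\<^sup>2 \<le> (D * D) * D ^ 5 * D\<^sup>2" by (rule mult_right_mono) simp
      also have "\<dots> = D ^ 9" by (simp add: power2_eq_square[symmetric] power_add[symmetric])
      also have "\<dots> = b ^ (9 * k)" by (simp add: D_def power_mult[symmetric] mult.commute)
      also have "\<dots> \<le> B"
        unfolding assms(7) using assms(1,2) by (intro power_increasing) (auto simp: power2_eq_square)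
      finally show "(E + 1) * D\<^sup>2 \<le> B" .
    qed (use X in auto)
    finally show ?thesis .
  qed
  have D1: "real D > 1" "real D \<ge> 1" using D9 by auto
  have N: "real N = real D ^ m" by (simp add: assms(10) m D_def power_mult)
  \<comment> \<open>The lower bound on \<open>N\<close> makes room for the long window.\<close>
  have rm: "r \<le> m"
  proof (rule power_le_imp_le_exp[OF D1(1)])
    have "2 * k * s \<le> s * D" using D(1) by simp
    then have "real D ^ r \<le> real D ^ (s * D)" unfolding r_def using D1(2) by (rule power_increasing)
    also have "\<dots> \<le> real D ^ m" using DB assms(14) by (simp add: X_def N)
    finally show "real D ^ r \<le> real D ^ m" .
  qed
  define c where "c = fact k * (\<theta> * d ^ k) * real b ^ sh"
  define R where "R = real D ^ (s * (k - 1))"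
  have sr: "s \<le> r" using assms(1) by (simp add: r_def)
  have digits: "d1 < b" "d2 < b" using assms(2,3,4) by auto
  have avg: "\<delta> \<le> norm ((\<Sum>S\<in>Pow {..<k * m}. exp2pi (\<theta> * (real d1 * (\<Sum>i<k * m. real b ^ i)
      + d * (\<Sum>i\<in>S. real b ^ i)) ^ k)) / 2 ^ (k * m))"
    using assms(13) mu_hat_eq[of k d1 b d2 n \<theta>] digits assms(1,5) by (simp add: m d_def)
  have approx: "\<exists>z::int. z \<noteq> 0 \<and> real_of_int \<bar>z\<bar> \<le> R \<and> dist_int (c * real D ^ l * of_int z) \<le> 1 / (2 * real D ^ r)"
    if l: "l \<le> k * (m - r)" for l
  proof -
    obtain z :: int where z: "z \<noteq> 0" "\<bar>z\<bar> \<le> int (D ^ (s * (k - 1)))"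
      "dist_int (c * real D ^ l * of_int z) \<le> 1 / (2 * real D ^ r)"
      using shift_approx[OF assms(1) _ s(1) sr rm assms(11) \<eta>(1) _ avg peel_loss _ l, of h] large assms(2) D9
      by (auto simp: D_def w_def c_def sh_def h_def)
    have "real_of_int \<bar>z\<bar> \<le> real_of_int (int (D ^ (s * (k - 1))))" using z(2) by (simp only: of_int_le_iff)
    then show ?thesis using z by (auto simp: R_def)
  qed
  obtain q where q: "q > 0" "real q \<le> R" "dist_int (c * real q) * real D ^ (k * (m - r)) \<le> R / (2 * real D ^ r)"
  proof -
    \<comment> \<open>The length \<open>r = 2 * k * s\<close> exceeds the exponent of
      \<open>R\<^sup>2\<close> by \<open>2 * s\<close>, which leaves room for the extra factor
      \<open>D\<close>.\<close>
    have "R\<^sup>2 * real D = real D ^ (2 * (s * (k - 1)) + 1)" by (simp add: R_def power_mult[symmetric] mult_ac)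
    also have "\<dots> < real D ^ r"
    proof (rule power_strict_increasing[OF _ D1(1)])
      have "2 * (s * (k - 1)) + 2 * s = r" using assms(1) by (cases k) (auto simp: r_def algebra_simps)
      then show "2 * (s * (k - 1)) + 1 < r" using s(1) by linarith
    qed
    finally show ?thesis using approx_chain[of D R "real D ^ r" "k * (m - r)" c] approx D9 that D1
      by (auto simp: R_def)
  qed
  \<comment> \<open>The added factors are those by which \<open>c\<close> differs from
    \<open>\<theta>\<close>, up to the sign of \<open>d ^ k\<close>.\<close>
  define q' where "q' = q * (fact k * nat \<bar>int d2 - int d1\<bar> ^ k * b ^ sh)"
  have "q' > 0" using q(1) assms(2,5) by (simp add: q'_def)
  moreover have "real q' \<le> X ^ B"
  proof -
    have "fact k \<le> D ^ k"
    proof -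
      have "fact k \<le> k ^ k" using fact_le_power[of k, where 'a = nat] by simp
      also have "\<dots> \<le> D ^ k" using D(1) by (intro power_mono) auto
      finally show ?thesis .
    qed
    moreover have "nat \<bar>int d2 - int d1\<bar> ^ k \<le> D"
      unfolding D_def using digits by (intro power_mono) auto
    moreover have "b ^ sh \<le> D ^ k"
    proof -
      have "sh \<le> (\<Sum>j<k. k)" unfolding sh_def by (intro sum_mono) auto
      then have "b ^ sh \<le> b ^ (k * k)" using assms(2) by (intro power_increasing) auto
      then show ?thesis by (simp add: D_def power_mult)
    qed
    ultimately have factor: "fact k * nat \<bar>int d2 - int d1\<bar> ^ k * b ^ sh \<le> D ^ k * D * D ^ k"
      by (intro mult_mono) auto
    have "q \<le> D ^ (s * (k - 1))" using q(2) by (simp add: R_def flip: of_nat_power)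
    then have "q' \<le> D ^ (s * (k - 1)) * (D ^ k * D * D ^ k)"
      unfolding q'_def using factor by (rule mult_le_mono)
    also have "\<dots> = D ^ (s * (k - 1) + (2 * k + 1))" by (simp add: power_add mult_2)
    also have "\<dots> \<le> D ^ (s * D)"
    proof (rule power_increasing)
      have "s * (k - 1) + (2 * k + 1) \<le> s * (k - 1) + s * (2 * k + 1)"
        using mult_le_mono1[of 1 s "2 * k + 1"] s(1) by (intro add_left_mono) (metis Suc_leI One_nat_def mult_1)
      also have "\<dots> = s * (3 * k)" using assms(1) by (cases k) (auto simp: algebra_simps)
      also have "\<dots> \<le> s * D" using D(1) by simp
      finally show "s * (k - 1) + (2 * k + 1) \<le> s * D" .
    qed (use D9 in auto)
    finally have "real q' \<le> real D ^ (s * D)" by (simp flip: of_nat_power)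
    then show ?thesis using DB by linarith
  qed
  moreover have "dist_int (\<theta> * real q') \<le> X ^ B / real N ^ k"
  proof -
    have "real (nat \<bar>int d2 - int d1\<bar>) = \<bar>d\<bar>" by (simp add: d_def)
    then have "\<theta> * real q' = \<theta> * (real q * (fact k * \<bar>d ^ k\<bar> * real b ^ sh))"
      by (simp add: q'_def power_abs)
    then have "\<theta> * real q' = c * real q \<or> \<theta> * real q' = - (c * real q)"
      by (cases "d ^ k \<ge> 0") (simp_all add: c_def mult_ac)
    then have "dist_int (\<theta> * real q') = dist_int (c * real q)" by (metis dist_int_minus)
    also have "\<dots> \<le> R / (2 * real D ^ r) / real D ^ (k * (m - r))"
      using q(3) D1 by (simp add: pos_le_divide_eq mult_ac)
    also have "\<dots> \<le> R / real D ^ r / real D ^ (k * (m - r))"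
      using D1 by (intro divide_right_mono frac_le) (auto simp: R_def)
    also have "\<dots> = R * real D ^ (k * r) / real D ^ r / real N ^ k"
    proof -
      have "k * (m - r) + k * r = m * k" using rm by (metis le_add_diff_inverse2 distrib_left mult.commute)
      then have "real N ^ k = real D ^ (k * (m - r)) * real D ^ (k * r)"
        by (simp add: N power_add[symmetric] power_mult[symmetric])
      then show ?thesis using D1 by (simp add: field_simps)
    qed
    also have "\<dots> \<le> X ^ B / real N ^ k"
    proof (rule divide_right_mono)
      \<comment> \<open>The shifts stop at \<open>k * (m - r)\<close>, which costs
        \<open>D ^ (k * r)\<close> against \<open>N ^ k\<close>. This is at most
        \<open>D ^ (s * D)\<close> by \<open>2 * k\<^sup>2 \<le> D\<close>, and the division by
        \<open>D ^ r\<close> absorbs \<open>R\<close>.\<close>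
      have "s * (k - 1) + k * r \<le> s * D + r"
      proof -
        have "k - 1 \<le> 2 * k" by linarith
        then have "s * (k - 1) \<le> r" unfolding r_def using mult_le_mono2[of "k - 1" "2 * k" s] by (simp add: mult_ac)
        moreover have "k * r \<le> s * D"
          using mult_le_mono2[OF D(2), of s] by (simp add: r_def power2_eq_square mult_ac)
        ultimately show ?thesis by simp
      qed
      then have "R * real D ^ (k * r) \<le> real D ^ (s * D + r)"
        unfolding R_def power_add[symmetric] using D1(2) by (intro power_increasing)
      then have "R * real D ^ (k * r) / real D ^ r \<le> real D ^ (s * D)"
        using D1 by (simp add: power_add pos_divide_le_eq)
      then show "R * real D ^ (k * r) / real D ^ r \<le> X ^ B" using DB by simp
    qed simp
    finally show ?thesis .
  qed
  ultimately show ?thesis unfolding X_def by blast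
qed

end
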